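(* Let $H$ be a Hopf algebra over an algebraically closed field $F$ of characteristic $0$ generated as an algebra by a Hopf subalgebra $\tilde H$ and a skew-primitive element $v\in H$, $\Delta v=g_1\otimes v+v\otimes g_2$, $g_1,g_2\in G(\tilde H)$. Suppose that there exists an algebra automorphism $\varphi\colon\tilde H\to\tilde H$ such that $vh-\varphi(h)v\in\tilde H$ for all $h\in\tilde H$. Suppose that all finite dimensional $\tilde H$-simple (associative) $\tilde H$-module algebras satisfy Property ( * ) (with respect to $\tilde H$). Then all finite dimensional $H$-simple (associative) $H$-module algebras satisfy Property ( * ) (with respect to $H$).
   Context: An algebra $A$ (not necessarily unital) is an $H$-module algebra for a Hopf algebra $H$ if it is a left $H$-module with $h(ab)=(h_{(1)}a)(h_{(2)}b)$ (Sweedler notation) for all $h\in H$, $a,b\in A$. $A$ is $H$-simple if $A^2\ne0$ and $A$ has no non-trivial two-sided ideals that are $H$-submodules. $G(\tilde H)$ is the group of group-like elements of $\tilde H$. $H$-polynomials: $F\langle X|H\rangle=\bigoplus_{n\ge1}H^{\otimes n}\otimes F\langle X\rangle^{(n)}$, where $X$ is a countable set of variables and $F\langle X\rangle^{(n)}$ is the span of noncommutative monomials of degree $n$, with multiplication $(u_1\otimes w_1)(u_2\otimes w_2)=(u_1\otimes u_2)\otimes w_1w_2$. One writes $x_{i_1}^{h_1}\cdots x_{i_n}^{h_n}:=(h_1\otimes\cdots\otimes h_n)\otimes x_{i_1}\cdots x_{i_n}$. $H$-polynomials are evaluated in $A$ by letting $x_i^h\mapsto ha_i$ when $x_i\mapsto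 a_i$. Multilinear means a linear combination of monomials $x^{h_1}_{\sigma(1)}\cdots x^{h_n}_{\sigma(n)}$, $h_i\in H$, $\sigma\in S_n$, in the given variables. Property ( * ): a finite dimensional algebra $B$ with an $H$-action and with basis $a_1,\ldots,a_\ell$ satisfies Property ( * ) if $B$ is unital and there is $n_0\in\mathbb N$ such that for every $k\in\mathbb N$ there exist a multilinear $H$-polynomial $f=f(x_1^{(1)},\ldots,x_\ell^{(1)};\ldots;x_1^{(2k)},\ldots,x_\ell^{(2k)};z_1,\ldots,z_{n_1})$ and elements $\bar z_i\in B$, $1\leqslant i\leqslant n_1$, $0\leqslant n_1\leqslant n_0$, such that $f$ is alternating in $x_1^{(i)},\ldots,x_\ell^{(i)}$ for each $1\leqslant i\leqslant2k$ and $f(a_1,\ldots,a_\ell;\ldots;a_1,\ldots,a_\ell;\bar z_1,\ldots,\bar z_{n_1})\ne0$. *)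

theory Defs
  imports
    Complex_Main
    "HOL-Library.Poly_Mapping"
    "HOL-Combinatorics.Permutations"
    "HOL-Computational_Algebra.Polynomial"
begin

section \<open>Tensor products as formal linear combinations\<close>

text \<open>
  The type \<open>'m \<Rightarrow>\<^sub>0 'f\<close> is the \<open>'f\<close>-vector space with basis \<open>'m\<close>.  Tensors, and later
  \<open>H\<close>-polynomials, are represented by formal linear combinations of pure tensors (respectively
  monomials).  Two representatives stand for the same element if and only if they differ by an
  element of the subspace spanned by the usual multilinearity relations (\<open>slot_relations\<close>), so
  this is the standard construction of the tensor product as a quotient of a free vector space.
\<close>

definition pscale :: "'f::field \<Rightarrow> ('m \<Rightarrow>\<^sub>0 'f) \<Rightarrow> ('m \<Rightarrow>\<^sub>0 'f)" where
  "pscale c p = Poly_Mapping.map ((*) c) p"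

lemma lookup_pscale [simp]: "Poly_Mapping.lookup (pscale c p) m = c * Poly_Mapping.lookup p m"
  by (simp add: pscale_def Poly_Mapping.map.rep_eq when_def)

interpretation free: vector_space "pscale :: 'f::field \<Rightarrow> ('m \<Rightarrow>\<^sub>0 'f) \<Rightarrow> ('m \<Rightarrow>\<^sub>0 'f)"
  by unfold_locales (auto intro!: poly_mapping_eqI simp: lookup_add algebra_simps)

abbreviation pure :: "'m \<Rightarrow> ('m \<Rightarrow>\<^sub>0 'f::field)" where
  "pure m \<equiv> Poly_Mapping.single m 1"

text \<open>The linear extension of a map \<open>g\<close> defined on the basis \<open>'m\<close>.\<close>

definition lin_ext :: "('f::field \<Rightarrow> 'b::ab_group_add \<Rightarrow> 'b) \<Rightarrow> ('m \<Rightarrow> 'b) \<Rightarrow> ('m \<Rightarrow>\<^sub>0 'f) \<Rightarrow> 'b" where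
  "lin_ext s g p = (\<Sum>m\<in>Poly_Mapping.keys p. s (Poly_Mapping.lookup p m) (g m))"

text \<open>
  A slot is a basis element with one hole to be filled by a vector from the subspace \<open>K\<close> (with
  scalar multiplication \<open>s\<close>); each slot \<open>c \<in> C\<close> is required to be linear.
\<close>

definition slot_relations ::
    "('f::field \<Rightarrow> 'h::ab_group_add \<Rightarrow> 'h) \<Rightarrow> 'h set \<Rightarrow> ('h \<Rightarrow> 'm) set \<Rightarrow> ('m \<Rightarrow>\<^sub>0 'f) set" where
  "slot_relations s K C = free.span
     ({pure (c (x + y)) - pure (c x) - pure (c y) | c x y. c \<in> C \<and> x \<in> K \<and> y \<in> K} \<union>
      {pure (c (s r x)) - pscale r (pure (c x)) | c r x. c \<in> C \<and> x \<in> K})"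

definition tensor2_eq ::
    "('f::field \<Rightarrow> 'h::ab_group_add \<Rightarrow> 'h) \<Rightarrow> ('h \<times> 'h \<Rightarrow>\<^sub>0 'f) \<Rightarrow> ('h \<times> 'h \<Rightarrow>\<^sub>0 'f) \<Rightarrow> bool" where
  "tensor2_eq s t u \<longleftrightarrow> t - u \<in> slot_relations s UNIV
     ({\<lambda>x. (x, b) | b. True} \<union> {\<lambda>x. (a, x) | a. True})"

definition tensor3_eq ::
    "('f::field \<Rightarrow> 'h::ab_group_add \<Rightarrow> 'h) \<Rightarrow> ('h \<times> 'h \<times> 'h \<Rightarrow>\<^sub>0 'f) \<Rightarrow> ('h \<times> 'h \<times> 'h \<Rightarrow>\<^sub>0 'f) \<Rightarrow> bool" where
  "tensor3_eq s t u \<longleftrightarrow> t - u \<in> slot_relations s UNIV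
     ({\<lambda>x. (x, b, c) | b c. True} \<union> {\<lambda>x. (a, x, c) | a c. True} \<union> {\<lambda>x. (a, b, x) | a b. True})"

definition tensor2_mult ::
    "('h::ring_1 \<times> 'h \<Rightarrow>\<^sub>0 'f::field) \<Rightarrow> ('h \<times> 'h \<Rightarrow>\<^sub>0 'f) \<Rightarrow> ('h \<times> 'h \<Rightarrow>\<^sub>0 'f)" where
  "tensor2_mult t u =
     lin_ext pscale (\<lambda>(a, b). lin_ext pscale (\<lambda>(c, d). pure (a * c, b * d)) u) t"


section \<open>Hopf algebras\<close>

text \<open>
  \<open>comult h\<close> is a representative \<open>\<Sum> h\<^sub>(\<^sub>1\<^sub>) \<otimes> h\<^sub>(\<^sub>2\<^sub>)\<close> of \<open>\<Delta>(h)\<close>; hence all axioms about \<open>\<Delta>\<close>,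
  including its linearity, are equalities in a tensor power of \<open>H\<close>.
\<close>

locale hopf_algebra = H: vector_space hscale
  for hscale :: "'f::field \<Rightarrow> 'h::ring_1 \<Rightarrow> 'h" +
  fixes comult :: "'h \<Rightarrow> ('h \<times> 'h \<Rightarrow>\<^sub>0 'f)"
    and counit :: "'h \<Rightarrow> 'f"
    and antipode :: "'h \<Rightarrow> 'h"
  assumes smult_mult_left: "hscale c (x * y) = hscale c x * y"
    and smult_mult_right: "hscale c (x * y) = x * hscale c y"
    and comult_add: "tensor2_eq hscale (comult (x + y)) (comult x + comult y)"
    and comult_smult: "tensor2_eq hscale (comult (hscale c x)) (pscale c (comult x))"
    and comult_one: "tensor2_eq hscale (comult 1) (pure (1, 1))"
    and comult_mult: "tensor2_eq hscale (comult (x * y)) (tensor2_mult (comult x) (comult y))"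
    and counit_add: "counit (x + y) = counit x + counit y"
    and counit_smult: "counit (hscale c x) = c * counit x"
    and counit_one: "counit 1 = 1"
    and counit_mult: "counit (x * y) = counit x * counit y"
    and coassoc: "tensor3_eq hscale
       (lin_ext pscale (\<lambda>(a, b). lin_ext pscale (\<lambda>(a1, a2). pure (a1, a2, b)) (comult a)) (comult x))
       (lin_ext pscale (\<lambda>(a, b). lin_ext pscale (\<lambda>(b1, b2). pure (a, b1, b2)) (comult b)) (comult x))"
    and counit_left: "lin_ext hscale (\<lambda>(a, b). hscale (counit a) b) (comult x) = x"
    and counit_right: "lin_ext hscale (\<lambda>(a, b). hscale (counit b) a) (comult x) = x"
    and antipode_add: "antipode (x + y) = antipode x + antipode y"
    and antipode_smult: "antipode (hscale c x) = hscale c (antipode x)"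
    and antipode_left: "lin_ext hscale (\<lambda>(a, b). antipode a * b) (comult x) = hscale (counit x) 1"
    and antipode_right: "lin_ext hscale (\<lambda>(a, b). a * antipode b) (comult x) = hscale (counit x) 1"
begin

definition subalgebra :: "'h set \<Rightarrow> bool" where
  "subalgebra B \<longleftrightarrow> H.subspace B \<and> 1 \<in> B \<and> (\<forall>x\<in>B. \<forall>y\<in>B. x * y \<in> B)"

text \<open>\<open>t\<close> is a representative of \<open>\<Delta>(h)\<close> that lies in \<open>K \<otimes> K\<close>.\<close>

definition sweedler :: "'h set \<Rightarrow> 'h \<Rightarrow> ('h \<times> 'h \<Rightarrow>\<^sub>0 'f) \<Rightarrow> bool" where
  "sweedler K h t \<longleftrightarrow> Poly_Mapping.keys t \<subseteq> K \<times> K \<and> tensor2_eq hscale (comult h) t"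

definition hopf_subalgebra :: "'h set \<Rightarrow> bool" where
  "hopf_subalgebra K \<longleftrightarrow>
     subalgebra K \<and> (\<forall>h\<in>K. \<exists>t. sweedler K h t) \<and> (\<forall>h\<in>K. antipode h \<in> K)"

definition group_likes :: "'h set \<Rightarrow> 'h set" where
  "group_likes K = {g \<in> K. g \<noteq> 0 \<and> tensor2_eq hscale (comult g) (pure (g, g))}"

definition algebra_automorphism_on :: "'h set \<Rightarrow> ('h \<Rightarrow> 'h) \<Rightarrow> bool" where
  "algebra_automorphism_on K \<phi> \<longleftrightarrow> bij_betw \<phi> K K \<and> \<phi> 1 = 1 \<and>
     (\<forall>x\<in>K. \<forall>y\<in>K. \<phi> (x + y) = \<phi> x + \<phi> y \<and> \<phi> (x * y) = \<phi> x * \<phi> y) \<and>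
     (\<forall>c. \<forall>x\<in>K. \<phi> (hscale c x) = hscale c (\<phi> x))"

lemma hopf_subalgebra_UNIV: "hopf_subalgebra UNIV"
proof -
  have "sweedler UNIV h (comult h)" for h
    by (simp add: sweedler_def tensor2_eq_def slot_relations_def free.span_zero)
  then show ?thesis
    unfolding hopf_subalgebra_def subalgebra_def by auto
qed

end


section \<open>Polynomials with Hopf action\<close>

text \<open>
  The countable variable set: \<open>X i j\<close> is the \<open>j\<close>-th variable of the \<open>i\<close>-th alternating block and
  \<open>Z j\<close> is an auxiliary variable; all indices start at \<open>0\<close>.  The monomial
  \<open>x\<^sub>1\<^sup>h\<^sup>1 \<dots> x\<^sub>n\<^sup>h\<^sup>n\<close>, i.e. \<open>(h\<^sub>1 \<otimes> \<dots> \<otimes> h\<^sub>n) \<otimes> x\<^sub>1 \<dots> x\<^sub>n\<close>, is the list of the pairs \<open>(x\<^sub>i, h\<^sub>i)\<close>.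
\<close>

datatype var = X nat nat | Z nat

type_synonym ('f, 'h) hpoly = "(var \<times> 'h) list \<Rightarrow>\<^sub>0 'f"

text \<open>
  Equality in \<open>F\<langle>X|K\<rangle> = \<Oplus>\<^sub>n K\<^sup>\<otimes>\<^sup>n \<otimes> F\<langle>X\<rangle>\<^sup>(\<^sup>n\<^sup>)\<close>: monomials are multilinear in their exponents.
\<close>

definition hpoly_eq ::
    "('f::field \<Rightarrow> 'h::ring_1 \<Rightarrow> 'h) \<Rightarrow> 'h set \<Rightarrow> ('f, 'h) hpoly \<Rightarrow> ('f, 'h) hpoly \<Rightarrow> bool" where
  "hpoly_eq s K p q \<longleftrightarrow> p - q \<in> slot_relations s K
     {\<lambda>h. u @ (x, h) # w | u x w. snd ` set (u @ w) \<subseteq> K}"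

text \<open>Linear combinations of monomials in which each variable from \<open>V\<close> occurs exactly once,
  and no other variable occurs, with exponents in \<open>K\<close>.\<close>

definition multilinear_hpoly :: "'h set \<Rightarrow> var set \<Rightarrow> ('f::field, 'h) hpoly \<Rightarrow> bool" where
  "multilinear_hpoly K V p \<longleftrightarrow> (\<forall>m\<in>Poly_Mapping.keys p.
     m \<noteq> [] \<and> distinct (map fst m) \<and> fst ` set m = V \<and> snd ` set m \<subseteq> K)"

definition rename_vars :: "(var \<Rightarrow> var) \<Rightarrow> ('f::field, 'h) hpoly \<Rightarrow> ('f, 'h) hpoly" where
  "rename_vars \<pi> p = lin_ext pscale (\<lambda>m. pure (map (apfst \<pi>) m)) p"

definition alternating_in ::
    "('f::field \<Rightarrow> 'h::ring_1 \<Rightarrow> 'h) \<Rightarrow> 'h set \<Rightarrow> var set \<Rightarrow> ('f, 'h) hpoly \<Rightarrow> bool" where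
  "alternating_in s K V p \<longleftrightarrow>
     (\<forall>\<pi>. \<pi> permutes V \<longrightarrow> hpoly_eq s K (rename_vars \<pi> p) (pscale (of_int (sign \<pi>)) p))"

text \<open>There is no constant term, so the value at the empty word is irrelevant.\<close>

fun eval_monomial ::
    "('a::ab_group_add \<Rightarrow> 'a \<Rightarrow> 'a) \<Rightarrow> ('h \<Rightarrow> 'a \<Rightarrow> 'a) \<Rightarrow> (var \<Rightarrow> 'a) \<Rightarrow> (var \<times> 'h) list \<Rightarrow> 'a" where
  "eval_monomial mul act \<rho> [] = 0"
| "eval_monomial mul act \<rho> [(x, h)] = act h (\<rho> x)"
| "eval_monomial mul act \<rho> ((x, h) # m # ms) =
     mul (act h (\<rho> x)) (eval_monomial mul act \<rho> (m # ms))"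


section \<open>Module algebras and Property (*)\<close>

text \<open>
  An associative, not necessarily unital, algebra on a subspace \<open>A\<close> of the vector space \<open>'a\<close>.
\<close>

locale assoc_algebra = vector_space scale
  for scale :: "'f::field \<Rightarrow> 'a::ab_group_add \<Rightarrow> 'a" +
  fixes A :: "'a set" and mul :: "'a \<Rightarrow> 'a \<Rightarrow> 'a"
  assumes subspace_carrier: "subspace A"
    and mul_closed: "\<lbrakk>a \<in> A; b \<in> A\<rbrakk> \<Longrightarrow> mul a b \<in> A"
    and mul_assoc: "\<lbrakk>a \<in> A; b \<in> A; c \<in> A\<rbrakk> \<Longrightarrow> mul (mul a b) c = mul a (mul b c)"
    and mul_add_left: "\<lbrakk>a \<in> A; b \<in> A; c \<in> A\<rbrakk> \<Longrightarrow> mul (a + b) c = mul a c + mul b c"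
    and mul_add_right: "\<lbrakk>a \<in> A; b \<in> A; c \<in> A\<rbrakk> \<Longrightarrow> mul a (b + c) = mul a b + mul a c"
    and mul_scale_left: "\<lbrakk>a \<in> A; b \<in> A\<rbrakk> \<Longrightarrow> mul (scale r a) b = scale r (mul a b)"
    and mul_scale_right: "\<lbrakk>a \<in> A; b \<in> A\<rbrakk> \<Longrightarrow> mul a (scale r b) = scale r (mul a b)"

text \<open>
  A module algebra over the Hopf subalgebra \<open>K\<close> (\<open>K = UNIV\<close> for \<open>H\<close> itself).  In the last axiom,
  \<open>h\<^sub>(\<^sub>1\<^sub>) \<otimes> h\<^sub>(\<^sub>2\<^sub>)\<close> runs over the representatives with components in \<open>K\<close>, because \<open>act\<close> is meaningful
  only on \<open>K\<close>.
\<close>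

locale module_algebra =
  hopf_algebra hscale comult counit antipode + assoc_algebra scale A mul
  for hscale :: "'f::field \<Rightarrow> 'h::ring_1 \<Rightarrow> 'h"
    and comult :: "'h \<Rightarrow> ('h \<times> 'h \<Rightarrow>\<^sub>0 'f)"
    and counit :: "'h \<Rightarrow> 'f"
    and antipode :: "'h \<Rightarrow> 'h"
    and scale :: "'f \<Rightarrow> 'a::ab_group_add \<Rightarrow> 'a"
    and A :: "'a set" and mul :: "'a \<Rightarrow> 'a \<Rightarrow> 'a" +
  fixes K :: "'h set" and act :: "'h \<Rightarrow> 'a \<Rightarrow> 'a"
  assumes hopf_subalgebra_K: "hopf_subalgebra K"
    and act_closed: "\<lbrakk>h \<in> K; a \<in> A\<rbrakk> \<Longrightarrow> act h a \<in> A"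
    and act_add_left: "\<lbrakk>h \<in> K; k \<in> K; a \<in> A\<rbrakk> \<Longrightarrow> act (h + k) a = act h a + act k a"
    and act_add_right: "\<lbrakk>h \<in> K; a \<in> A; b \<in> A\<rbrakk> \<Longrightarrow> act h (a + b) = act h a + act h b"
    and act_smult: "\<lbrakk>h \<in> K; a \<in> A\<rbrakk> \<Longrightarrow> act (hscale r h) a = scale r (act h a)"
    and act_scale: "\<lbrakk>h \<in> K; a \<in> A\<rbrakk> \<Longrightarrow> act h (scale r a) = scale r (act h a)"
    and act_one: "a \<in> A \<Longrightarrow> act 1 a = a"
    and act_mult: "\<lbrakk>h \<in> K; k \<in> K; a \<in> A\<rbrakk> \<Longrightarrow> act (h * k) a = act h (act k a)"
    and act_mul: "\<lbrakk>h \<in> K; sweedler K h t; a \<in> A; b \<in> A\<rbrakk> \<Longrightarrow>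
       act h (mul a b) = lin_ext scale (\<lambda>(h1, h2). mul (act h1 a) (act h2 b)) t"
begin

definition finite_dimensional :: bool where
  "finite_dimensional \<longleftrightarrow> (\<exists>B. finite B \<and> B \<subseteq> A \<and> span B = A)"

definition invariant_ideal :: "'a set \<Rightarrow> bool" where
  "invariant_ideal I \<longleftrightarrow> subspace I \<and> I \<subseteq> A \<and>
     (\<forall>a\<in>A. \<forall>x\<in>I. mul a x \<in> I \<and> mul x a \<in> I) \<and> (\<forall>h\<in>K. \<forall>x\<in>I. act h x \<in> I)"

definition simple :: bool where
  "simple \<longleftrightarrow> span {mul a b | a b. a \<in> A \<and> b \<in> A} \<noteq> {0} \<and>
     (\<forall>I. invariant_ideal I \<longrightarrow> I = {0} \<or> I = A)"

definition unital :: bool where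
  "unital \<longleftrightarrow> (\<exists>e\<in>A. \<forall>a\<in>A. mul e a = a \<and> mul a e = a)"

definition is_basis :: "'a list \<Rightarrow> bool" where
  "is_basis as \<longleftrightarrow> distinct as \<and> independent (set as) \<and> span (set as) = A"

definition eval_hpoly :: "(var \<Rightarrow> 'a) \<Rightarrow> ('f, 'h) hpoly \<Rightarrow> 'a" where
  "eval_hpoly \<rho> f = lin_ext scale (eval_monomial mul act \<rho>) f"

text \<open>Property (*) of the algebra with the basis \<open>as\<close>; here \<open>zs\<close> is the list of the
  \<open>n\<^sub>1\<close> elements substituted for the variables \<open>Z j\<close>.\<close>

definition property_star :: "'a list \<Rightarrow> bool" where
  "property_star as \<longleftrightarrow> unital \<and>
     (\<exists>n0::nat. \<forall>k::nat. \<exists>(f :: ('f, 'h) hpoly) zs.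
        length zs \<le> n0 \<and> set zs \<subseteq> A \<and>
        multilinear_hpoly K ({X i j | i j. i < 2 * k \<and> j < length as} \<union> {Z j | j. j < length zs}) f \<and>
        (\<forall>i<2 * k. alternating_in hscale K {X i j | j. j < length as} f) \<and>
        eval_hpoly (case_var (\<lambda>i j. as ! j) (\<lambda>j. zs ! j)) f \<noteq> 0)"

end

text \<open>
  All finite dimensional \<open>K\<close>-simple \<open>K\<close>-module algebras whose underlying space is a subspace of the
  vector space \<open>'a\<close> have Property (*) (with respect to each of their bases).  Every finite dimensional
  vector space over \<open>'f\<close> is isomorphic to a subspace of \<open>nat \<Rightarrow>\<^sub>0 'f\<close>, so the instance
  \<open>'a = (nat \<Rightarrow>\<^sub>0 'f)\<close>, \<open>scale = pscale\<close> covers all such algebras up to isomorphism.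
\<close>

definition all_simple_have_property_star ::
    "('f::field \<Rightarrow> 'h::ring_1 \<Rightarrow> 'h) \<Rightarrow> ('h \<Rightarrow> ('h \<times> 'h \<Rightarrow>\<^sub>0 'f)) \<Rightarrow> ('h \<Rightarrow> 'f) \<Rightarrow> ('h \<Rightarrow> 'h) \<Rightarrow>
     'h set \<Rightarrow> ('f \<Rightarrow> 'a::ab_group_add \<Rightarrow> 'a) \<Rightarrow> bool" where
  "all_simple_have_property_star hscale comult counit antipode K scale \<longleftrightarrow>
     (\<forall>A mul act as.
        module_algebra hscale comult counit antipode scale A mul K act \<and>
        module_algebra.finite_dimensional scale A \<and>
        module_algebra.simple scale A mul K act \<and>
        module_algebra.is_basis scale A as \<longrightarrow>
        module_algebra.property_star hscale scale A mul K act as)"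

end

theory Submission
  imports Defs
begin

text \<open>
  Let \<open>I\<close> be a minimal nonzero \<open>Ht\<close>-invariant ideal of the \<open>H\<close>-simple algebra \<open>A\<close>.  The ideals
  \<open>W k = I + v I + \<dots> + v\<^sup>k\<^sup>-\<^sup>1 I\<close> are \<open>Ht\<close>-invariant and exhaust \<open>A = W (T + 1)\<close>, and \<open>v\<close> maps each factor
  \<open>W (k + 1) / W k\<close> bijectively onto the next one, up to a twist.  Hence \<open>A / W T\<close> is \<open>Ht\<close>-simple,
  a lift of its unit acts unipotently on \<open>A\<close>, which makes \<open>A\<close> unital, and the vectors \<open>v\<^sup>i c\<^sub>j\<close>
  (\<open>i \<le> T\<close>, \<open>c\<close> a basis of \<open>I\<close>) form a basis of \<open>A\<close> whose layer \<open>i = T\<close> is a basis of \<open>A / W T\<close>.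

  Take the polynomial of Property (*) for \<open>A / W T\<close> with \<open>2 k (T + 1)\<close> blocks, assign \<open>T + 1\<close> of its
  blocks to the \<open>T + 1\<close> layers of each block for \<open>A\<close>, multiply the exponents at layer \<open>i\<close> by
  \<open>v\<^sup>T\<^sup>-\<^sup>i\<close>, and alternate.  Modulo \<open>W T\<close> a permutation contributes to the value at the layered basis
  only if it never lowers the layer; such a permutation preserves all layers and contributes the same
  nonzero value as the identity.
\<close>

section \<open>Linear extensions and bases\<close>

text \<open>The hypothesis applies only to algebras with nonzero products, and nothing prevents all
  products inside \<open>I\<close> from vanishing. The top factor \<open>A / W T\<close> is safe:
  the products of \<open>A\<close> span an \<open>H\<close>-invariant ideal, hence all of
  \<open>A\<close>, so they cannot all lie in \<open>W T\<close>. The action of \<open>v\<close>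
  need not descend to this quotient. It is therefore spent on the arguments before projecting, after
  which only \<open>Ht\<close> acts. The number of blocks is a matter of dimensions: with
  \<open>d = dim I\<close>, a basis of \<open>A\<close> has \<open>(T + 1) d\<close> elements and a
  basis of \<open>A / W T\<close> has \<open>d\<close>, so \<open>T + 1\<close> blocks for the
  quotient fill exactly one block for \<open>A\<close>. The auxiliary variables are not touched, so
  the bound \<open>n0\<close> is inherited unchanged. The contributing permutations all give the
  same value, so their number must be nonzero in the field; characteristic 0 ensures this.\<close>

lemma lin_ext_superset:
  assumes "vector_space s" "finite S" "Poly_Mapping.keys p \<subseteq> S"
  shows "lin_ext s g p = (\<Sum>m\<in>S. s (Poly_Mapping.lookup p m) (g m))"
proof -
  interpret vector_space s by fact
  show ?thesis unfolding lin_ext_def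
    by (rule sum.mono_neutral_left) (use assms in \<open>auto simp: in_keys_iff\<close>)
qed

lemma linear_lin_ext:
  assumes "vector_space s"
  shows "Vector_Spaces.linear pscale s (lin_ext s g)"
proof -
  interpret vector_space s by fact
  have add: "lin_ext s g (p + q) = lin_ext s g p + lin_ext s g q" for p q
  proof -
    let ?S = "Poly_Mapping.keys p \<union> Poly_Mapping.keys q"
    have "Poly_Mapping.keys (p + q) \<subseteq> ?S" by (rule keys_add)
    then show ?thesis
      by (simp add: lin_ext_superset[OF assms, of ?S] lookup_add scale_left_distrib sum.distrib)
  qed
  have smult: "lin_ext s g (pscale c p) = s c (lin_ext s g p)" for c p
  proof -
    have "Poly_Mapping.keys (pscale c p) \<subseteq> Poly_Mapping.keys p"
      by (auto simp: in_keys_iff)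
    then show ?thesis
      by (simp add: lin_ext_superset[OF assms, of "Poly_Mapping.keys p"] scale_sum_right)
  qed
  show ?thesis
    by (simp add: Vector_Spaces.linear_iff add smult assms free.vector_space_axioms)
qed

lemma lin_ext_pure [simp]:
  assumes "vector_space s"
  shows "lin_ext s g (pure m) = g m"
proof -
  interpret vector_space s by fact
  show ?thesis by (simp add: lin_ext_def)
qed

lemma lin_ext_compose:
  assumes "Vector_Spaces.linear s s' L"
  shows "L (lin_ext s g p) = lin_ext s' (\<lambda>m. L (g m)) p"
proof -
  interpret L: Vector_Spaces.linear s s' L by fact
  show ?thesis by (simp add: lin_ext_def L.sum L.scale)
qed

lemma lin_ext_cong:
  "(\<And>m. m \<in> Poly_Mapping.keys p \<Longrightarrow> g m = g' m) \<Longrightarrow> lin_ext s g p = lin_ext s g' p"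
  by (simp add: lin_ext_def)

lemma (in vector_space) lin_ext_in_subspace:
  "subspace S \<Longrightarrow> (\<And>m. m \<in> Poly_Mapping.keys p \<Longrightarrow> g m \<in> S) \<Longrightarrow> lin_ext scale g p \<in> S"
  unfolding lin_ext_def by (intro subspace_sum subspace_scale)

lemma subspace_keys: "free.subspace {p. Poly_Mapping.keys p \<subseteq> M}"
proof -
  have "Poly_Mapping.keys (p + q) \<subseteq> M"
    if "Poly_Mapping.keys p \<subseteq> M" "Poly_Mapping.keys q \<subseteq> M" for p q :: "'b \<Rightarrow>\<^sub>0 'a"
    using keys_add[of p q] that by blast
  moreover have "Poly_Mapping.keys (pscale c p) \<subseteq> Poly_Mapping.keys p" for c and p :: "'b \<Rightarrow>\<^sub>0 'a"
    by (auto simp: in_keys_iff)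
  ultimately show ?thesis
    unfolding free.subspace_def by (metis (mono_tags) keys_zero empty_subsetI mem_Collect_eq order_trans)
qed

text \<open>The universal property of the quotient: the kernel of a linear extension is a subspace,
  so it contains all relations as soon as it contains the generating ones. Every passage from
  representatives to tensors or to \<open>H\<close>-polynomials rests on this.\<close>

lemma lin_ext_slot_relations:
  assumes "vector_space s'"
    and add: "\<And>c x y. c \<in> C \<Longrightarrow> x \<in> K \<Longrightarrow> y \<in> K \<Longrightarrow> g (c (x + y)) = g (c x) + g (c y)"
    and smult: "\<And>c r x. c \<in> C \<Longrightarrow> x \<in> K \<Longrightarrow> g (c (s r x)) = s' r (g (c x))"
    and rel: "t \<in> slot_relations s K C"
  shows "lin_ext s' g t = 0"
proof -
  interpret vector_space s' by fact
  interpret L: Vector_Spaces.linear pscale s' "lin_ext s' g"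
    by (rule linear_lin_ext) fact
  show ?thesis
    using rel unfolding slot_relations_def
  proof (induction rule: free.span_induct)
    case base
    show ?case by (rule L.subspace_kernel)
  qed (auto simp: assms L.diff L.scale)
qed

lemma lin_ext_tensor2_eq:
  assumes "vector_space s'"
    and "\<And>x y b. g (x + y, b) = g (x, b) + g (y, b)" "\<And>a x y. g (a, x + y) = g (a, x) + g (a, y)"
    and "\<And>r x b. g (s r x, b) = s' r (g (x, b))" "\<And>r a x. g (a, s r x) = s' r (g (a, x))"
    and eq: "tensor2_eq s t u"
  shows "lin_ext s' g t = lin_ext s' g u"
proof -
  interpret L: Vector_Spaces.linear pscale s' "lin_ext s' g"
    by (rule linear_lin_ext) fact
  have "lin_ext s' g (t - u) = 0"
    by (rule lin_ext_slot_relations[OF assms(1) _ _ eq[unfolded tensor2_eq_def]]) (auto simp: assms)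
  then show ?thesis by (simp add: L.diff)
qed

context vector_space
begin

lemma independent_family:
  assumes "\<And>u. (\<Sum>j<n. scale (u j) (x j)) = 0 \<Longrightarrow> \<forall>j<n. u j = 0"
  shows "distinct (map x [0..<n]) \<and> independent (set (map x [0..<n]))"
proof -
  have inj: "inj_on x {..<n}"
  proof (rule inj_onI, rule ccontr)
    fix i j assume ij: "i \<in> {..<n}" "j \<in> {..<n}" "x i = x j" "i \<noteq> j"
    \<comment> \<open>The difference of two unit coefficient vectors: a nontrivial relation if two
      members of the family coincide.\<close>
    let ?u = "\<lambda>l. (if l = i then 1 else 0) - (if l = j then 1 else 0)"
    have "(\<Sum>l<n. scale (?u l) (x l)) = 0"
      using ij by (simp add: scale_left_diff_distrib sum_subtractf if_distrib[of "\<lambda>c. scale c _"] cong: if_cong)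
    from assms[OF this] ij show False by auto
  qed
  have "independent (x ` {..<n})"
  proof (rule independent_if_scalars_zero)
    fix f y assume "(\<Sum>y\<in>x ` {..<n}. scale (f y) y) = 0" and y: "y \<in> x ` {..<n}"
    then have "(\<Sum>j<n. scale (f (x j)) (x j)) = 0"
      by (simp add: sum.reindex[OF inj])
    from assms[OF this] y show "f y = 0" by auto
  qed simp
  with inj show ?thesis
    by (simp add: distinct_map atLeast0LessThan)
qed

lemma span_family_explicit:
  fixes n :: nat
  shows "y \<in> span (x ` {..<n}) \<longleftrightarrow> (\<exists>u. y = (\<Sum>j<n. scale (u j) (x j)))"
proof
  assume "y \<in> span (x ` {..<n})"
  then show "\<exists>u. y = (\<Sum>j<n. scale (u j) (x j))"
  proof (induction rule: span_induct_alt)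
    case base
    show ?case by (rule exI[of _ "\<lambda>_. 0"]) simp
  next
    case (step c z y)
    then obtain i u where i: "i < n" "z = x i" "y = (\<Sum>j<n. scale (u j) (x j))" by auto
    show ?case
      by (rule exI[of _ "\<lambda>j. (if j = i then c else 0) + u j"])
        (use i in \<open>simp add: scale_left_distrib sum.distrib if_distrib[of "\<lambda>c. scale c _"] cong: if_cong\<close>)
  qed
next
  show "\<exists>u. y = (\<Sum>j<n. scale (u j) (x j)) \<Longrightarrow> y \<in> span (x ` {..<n})"
    by (elim exE, hypsubst) (intro span_sum span_scale span_base, simp)
qed

lemma subspace_bounded_dim:
  assumes "finite B" "subspace S" "S \<subseteq> span B"
  obtains C where "finite C" "independent C" "C \<subseteq> S" "span C = S" "card C = dim S" "dim S \<le> card B"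
proof -
  obtain C where C: "C \<subseteq> S" "independent C" "S \<subseteq> span C" "card C = dim S"
    using basis_exists by blast
  have "finite C \<and> card C \<le> card B"
    using independent_span_bound[of B C] C assms by auto
  moreover have "span C = S"
    using C assms span_minimal[of C S] by auto
  ultimately show ?thesis using that C by metis
qed

lemma dim_psubset_subspace:
  assumes "finite B" "subspace S" "subspace S'" "S \<subset> S'" "S' \<subseteq> span B"
  shows "dim S < dim S'"
proof -
  obtain C where C: "finite C" "independent C" "C \<subseteq> S" "span C = S" "card C = dim S"
    using subspace_bounded_dim[OF assms(1,2)] assms(4,5) by (metis psubset_imp_subset subset_trans)
  obtain C' where C': "finite C'" "span C' = S'" "card C' = dim S'"
    using subspace_bounded_dim[OF assms(1,3,5)] by metis
  obtain x where x: "x \<in> S'" "x \<notin> S" using assms by auto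
  have "independent (insert x C)"
    using C x by (simp add: independent_insert)
  moreover have "insert x C \<subseteq> span C'" using C C' x assms by auto
  ultimately have "card (insert x C) \<le> card C'"
    using independent_span_bound[OF C'(1)] by blast
  then show ?thesis
    using C C' x by (metis card_insert_disjoint less_eq_Suc_le span_base)
qed

text \<open>Realises \<open>A / J\<close> inside the finitely supported sequences, the one vector
  space over which the hypothesis on \<open>Ht\<close>-simple algebras ranges. A basis
  \<open>C\<close> of \<open>J\<close> is extended to a basis \<open>D\<close> of \<open>A\<close>;
  the vectors of \<open>C\<close> go to 0 and those of \<open>D - C\<close> to distinct unit
  vectors.\<close>

lemma linear_map_with_kernel:
  assumes "finite B" "subspace J" "J \<subseteq> A" "span B = A"
  obtains p :: "'b \<Rightarrow> (nat \<Rightarrow>\<^sub>0 'a)" where "Vector_Spaces.linear scale pscale p"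
    "\<And>a. a \<in> A \<Longrightarrow> p a = 0 \<longleftrightarrow> a \<in> J"
proof -
  interpret pr: vector_space_pair scale "pscale :: 'a \<Rightarrow> (nat \<Rightarrow>\<^sub>0 'a) \<Rightarrow> _" ..
  obtain C where C: "finite C" "independent C" "C \<subseteq> J" "span C = J"
    using subspace_bounded_dim[OF assms(1,2)] assms(3,4) by metis
  obtain D where D: "C \<subseteq> D" "D \<subseteq> A" "independent D" "A \<subseteq> span D"
    using maximal_independent_subset_extend[of C A] C assms by auto
  have finD: "finite D"
    using independent_span_bound[of B D] D assms by auto
  obtain num :: "'b \<Rightarrow> nat" where num: "inj_on num D"
    using finD finite_imp_inj_to_nat_seg by metis
  obtain p where p: "Vector_Spaces.linear scale pscale p"
    "\<forall>x\<in>D. p x = (if x \<in> C then 0 else pure (num x))"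
    using pr.linear_independent_extend[OF D(3), of "\<lambda>x. if x \<in> C then 0 else pure (num x)"]
    by (elim exE conjE)
  interpret p: Vector_Spaces.linear scale pscale p by fact
  have "p a = 0 \<longleftrightarrow> a \<in> J" if "a \<in> A" for a
  proof
    assume "p a = 0"
    have "a \<in> span D" using D that by auto
    then obtain u where u: "a = (\<Sum>x\<in>D. scale (u x) x)"
      using span_finite[OF finD] by auto
    have "u b = 0" if b: "b \<in> D - C" for b
    proof -
      have "0 = Poly_Mapping.lookup (p a) (num b)" using \<open>p a = 0\<close> by simp
      also have "\<dots> = (\<Sum>x\<in>D. u x * (if x \<in> C then 0 else (if x = b then 1 else 0)))"
        using p(2) b num
        by (auto simp: u p.sum p.scale lookup_sum lookup_single when_def inj_on_eq_iff intro!: sum.cong)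
      also have "\<dots> = (\<Sum>x\<in>D. if x = b then u x else 0)"
        by (rule sum.cong) (use b in auto)
      also have "\<dots> = u b" using b finD by simp
      finally show ?thesis by simp
    qed
    then have "a = (\<Sum>x\<in>C. scale (u x) x)"
      unfolding u by (intro sum.mono_neutral_right) (use finD D in auto)
    also have "\<dots> \<in> span C" by (intro span_sum span_scale span_base)
    finally show "a \<in> J" using C by simp
  next
    assume "a \<in> J"
    then have a: "a \<in> span C" using C by simp
    have "p x = 0" if "x \<in> C" for x using p(2) D(1) that by auto
    from p.eq_0_on_span[OF this a] show "p a = 0" .
  qed
  from that[OF p(1) this] show ?thesis .
qed

end

section \<open>Evaluation of polynomials\<close>

text \<open>Separates the product from the substitution in \<open>eval_monomial\<close>. On plain
  lists, linearity in one factor is an induction on the factors to its left.\<close>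

fun word_prod :: "('a::ab_group_add \<Rightarrow> 'a \<Rightarrow> 'a) \<Rightarrow> 'a list \<Rightarrow> 'a" where
  "word_prod mul [] = 0"
| "word_prod mul [a] = a"
| "word_prod mul (a # b # bs) = mul a (word_prod mul (b # bs))"

lemma word_prod_Cons: "bs \<noteq> [] \<Longrightarrow> word_prod mul (a # bs) = mul a (word_prod mul bs)"
  by (cases bs) auto

lemma eval_monomial_word_prod:
  "eval_monomial mul act \<rho> m = word_prod mul (map (\<lambda>(x, h). act h (\<rho> x)) m)"
  by (induction mul act \<rho> m rule: eval_monomial.induct) auto

lemma sign_transpose: "a \<noteq> b \<Longrightarrow> sign (transpose a b) = - 1"
  by (simp add: sign_swap_id)

text \<open>Induction on a set containing the support: composing \<open>\<sigma>\<close> with the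
  transposition of \<open>a\<close> and \<open>\<sigma> a\<close> fixes \<open>a\<close>, and these
  two points have the same label because \<open>\<sigma>\<close> preserves labels. So a
  label-preserving permutation is a product of label-preserving transpositions.\<close>

lemma fiber_permutation_induct [consumes 3, case_names id swap]:
  assumes "finite V" "\<sigma> permutes V" "\<And>x. q (\<sigma> x) = q x"
    and "P id"
    and swap: "\<And>\<tau> a b. \<lbrakk>\<tau> permutes V; \<And>x. q (\<tau> x) = q x; a \<in> V; b \<in> V; a \<noteq> b; q a = q b; P \<tau>\<rbrakk> \<Longrightarrow>
      P (transpose a b \<circ> \<tau>)"
  shows "P \<sigma>"
proof -
  have "P \<sigma>" if "finite U" "U \<subseteq> V" "\<sigma> permutes U" "\<And>x. q (\<sigma> x) = q x" for U \<sigma>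
    using that
  proof (induction U arbitrary: \<sigma> rule: finite_induct)
    case empty
    then show ?case using \<open>P id\<close> by (metis permutes_empty)
  next
    case (insert a U)
    define \<tau> where "\<tau> = transpose a (\<sigma> a) \<circ> \<sigma>"
    have \<tau>: "\<tau> permutes U"
      unfolding \<tau>_def by (rule permutes_insert_lemma) (use insert in auto)
    have q: "q (\<tau> x) = q x" for x
      using insert.prems(3)[of x] insert.prems(3)[of a] by (auto simp: \<tau>_def transpose_def)
    have "P \<tau>" using insert \<tau> q by auto
    moreover have "\<sigma> = transpose a (\<sigma> a) \<circ> \<tau>"
      by (simp add: \<tau>_def fun_eq_iff)
    moreover have "\<sigma> a \<in> V"
      using insert.prems permutes_in_image[of \<sigma> "insert a U" a] by auto
    moreover have "\<tau> permutes V" using \<tau> insert.prems by (auto intro: permutes_subset)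
    ultimately show ?case
      using swap[of \<tau> a "\<sigma> a"] q insert.prems by (cases "\<sigma> a = a") auto
  qed
  from this[OF assms(1) order.refl assms(2,3)] show ?thesis .
qed

context hopf_algebra
begin

text \<open>The counit axiom applied to \<open>g \<otimes> g\<close> says that
  \<open>counit g\<close> times \<open>g\<close> is \<open>g\<close>, so \<open>counit g = 1\<close>
  because \<open>g\<close> is nonzero; the antipode axioms then make \<open>antipode g\<close> the
  inverse of \<open>g\<close>.\<close>

lemma group_like_inverse:
  assumes "g \<in> group_likes K"
  shows "antipode g * g = 1" "g * antipode g = 1"
proof -
  have g: "g \<noteq> 0" "tensor2_eq hscale (comult g) (pure (g, g))"
    using assms by (auto simp: group_likes_def)
  have "lin_ext hscale (\<lambda>(a, b). hscale (counit a) b) (comult g) =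
      lin_ext hscale (\<lambda>(a, b). hscale (counit a) b) (pure (g, g))"
    by (rule lin_ext_tensor2_eq[OF H.vector_space_axioms _ _ _ _ g(2)])
      (simp_all add: counit_add counit_smult algebra_simps H.scale_left_distrib H.scale_right_distrib)
  then have "hscale (counit g) g = hscale 1 g"
    by (simp add: counit_left H.vector_space_axioms)
  then have c: "counit g = 1" using g H.scale_cancel_right by blast
  have "lin_ext hscale (\<lambda>(a, b). antipode a * b) (comult g) =
      lin_ext hscale (\<lambda>(a, b). antipode a * b) (pure (g, g))"
    by (rule lin_ext_tensor2_eq[OF H.vector_space_axioms _ _ _ _ g(2)])
      (simp_all add: antipode_add antipode_smult algebra_simps smult_mult_left[symmetric] smult_mult_right[symmetric])
  then show "antipode g * g = 1"
    by (simp add: antipode_left H.vector_space_axioms c)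
  have "lin_ext hscale (\<lambda>(a, b). a * antipode b) (comult g) =
      lin_ext hscale (\<lambda>(a, b). a * antipode b) (pure (g, g))"
    by (rule lin_ext_tensor2_eq[OF H.vector_space_axioms _ _ _ _ g(2)])
      (simp_all add: antipode_add antipode_smult algebra_simps smult_mult_left[symmetric] smult_mult_right[symmetric])
  then show "g * antipode g = 1"
    by (simp add: antipode_right H.vector_space_axioms c)
qed

end

context assoc_algebra
begin

lemma mul_0_left: "a \<in> A \<Longrightarrow> mul 0 a = 0"
  using mul_scale_left[of 0 a 0] subspace_carrier by (simp add: subspace_0)

lemma mul_0_right: "a \<in> A \<Longrightarrow> mul a 0 = 0"
  using mul_scale_right[of a 0 0] subspace_carrier by (simp add: subspace_0)

lemma mul_diff_left: "\<lbrakk>a \<in> A; b \<in> A; c \<in> A\<rbrakk> \<Longrightarrow> mul (a - b) c = mul a c - mul b c"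
  using mul_add_left[of "a - b" b c] subspace_carrier by (simp add: subspace_diff)

lemma mul_diff_right: "\<lbrakk>a \<in> A; b \<in> A; c \<in> A\<rbrakk> \<Longrightarrow> mul a (b - c) = mul a b - mul a c"
  using mul_add_right[of a "b - c" c] subspace_carrier by (simp add: subspace_diff)

lemma word_prod_closed: "set as \<subseteq> A \<Longrightarrow> word_prod mul as \<in> A"
proof (induction as)
  case Nil
  then show ?case using subspace_carrier by (simp add: subspace_0)
next
  case (Cons a as)
  then show ?case by (cases "as = []") (auto simp: word_prod_Cons mul_closed)
qed

lemma word_prod_add:
  assumes "set (u @ w) \<subseteq> A" "y \<in> A" "z \<in> A"
  shows "word_prod mul (u @ (y + z) # w) = word_prod mul (u @ y # w) + word_prod mul (u @ z # w)"
  using assms(1)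
proof (induction u)
  case Nil
  then show ?case
    using assms by (cases w) (auto intro!: mul_add_left word_prod_closed)
next
  case (Cons a u)
  then show ?case
    using assms by (auto simp: word_prod_Cons intro!: mul_add_right word_prod_closed)
qed

lemma word_prod_scale:
  assumes "set (u @ w) \<subseteq> A" "y \<in> A"
  shows "word_prod mul (u @ scale c y # w) = scale c (word_prod mul (u @ y # w))"
  using assms(1)
proof (induction u)
  case Nil
  then show ?case
    using assms by (cases w) (auto intro!: mul_scale_left word_prod_closed)
next
  case (Cons a u)
  then show ?case
    using assms by (auto simp: word_prod_Cons intro!: mul_scale_right word_prod_closed)
qed

lemma word_prod_hom:
  assumes "\<And>a b. a \<in> A \<Longrightarrow> b \<in> A \<Longrightarrow> p (mul a b) = mul' (p a) (p b)" "p 0 = 0" "set as \<subseteq> A"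
  shows "p (word_prod mul as) = word_prod mul' (map p as)"
  using assms(3)
proof (induction as)
  case (Cons a as)
  then show ?case
    using assms by (cases "as = []") (auto simp: word_prod_Cons word_prod_closed)
qed (simp add: assms)

end

context module_algebra
begin

lemma eval_hpoly_linear: "Vector_Spaces.linear pscale scale (eval_hpoly \<rho>)"
  unfolding eval_hpoly_def by (rule linear_lin_ext) (rule vector_space_axioms)

lemma eval_hpoly_rename: "eval_hpoly \<rho> (rename_vars \<sigma> p) = eval_hpoly (\<rho> \<circ> \<sigma>) p"
proof -
  have "eval_hpoly \<rho> (rename_vars \<sigma> p) =
      lin_ext scale (\<lambda>m. eval_hpoly \<rho> (pure (map (apfst \<sigma>) m))) p"
    unfolding rename_vars_def by (rule lin_ext_compose[OF eval_hpoly_linear])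
  also have "\<dots> = eval_hpoly (\<rho> \<circ> \<sigma>) p"
    unfolding eval_hpoly_def
    by (intro lin_ext_cong)
      (simp add: vector_space_axioms eval_monomial_word_prod comp_def case_prod_unfold)
  finally show ?thesis .
qed

text \<open>Evaluation is well defined on classes of representatives. All values of
  \<open>\<rho>\<close> must lie in \<open>A\<close>, since the relations may involve any variable
  and the module axioms hold only on \<open>A\<close>.\<close>

lemma eval_hpoly_eq:
  assumes "\<And>x. \<rho> x \<in> A" "hpoly_eq hscale K p q"
  shows "eval_hpoly \<rho> p = eval_hpoly \<rho> q"
proof -
  interpret L: Vector_Spaces.linear pscale scale "eval_hpoly \<rho>" by (rule eval_hpoly_linear)
  have in_A: "set (map (\<lambda>(x, h). act h (\<rho> x)) (u @ w)) \<subseteq> A" if "snd ` set (u @ w) \<subseteq> K" for u w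
    using that assms(1) by (fastforce intro!: act_closed)
  have "eval_hpoly \<rho> (p - q) = 0"
    unfolding eval_hpoly_def
  proof (rule lin_ext_slot_relations[OF vector_space_axioms _ _ assms(2)[unfolded hpoly_eq_def]])
    fix c :: "'h \<Rightarrow> (var \<times> 'h) list" and h k r
    assume c: "c \<in> {\<lambda>h. u @ (x, h) # w | u x w. snd ` set (u @ w) \<subseteq> K}" and h: "h \<in> K"
    then obtain u x w where c: "c = (\<lambda>h. u @ (x, h) # w)" "snd ` set (u @ w) \<subseteq> K" by auto
    show "eval_monomial mul act \<rho> (c (h + k)) = eval_monomial mul act \<rho> (c h) + eval_monomial mul act \<rho> (c k)"
      if "k \<in> K"
      using word_prod_add[OF in_A[OF c(2), unfolded map_append], of "act h (\<rho> x)" "act k (\<rho> x)"] h that assms(1)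
      by (simp add: c eval_monomial_word_prod act_add_left act_closed)
    show "eval_monomial mul act \<rho> (c (hscale r h)) = scale r (eval_monomial mul act \<rho> (c h))"
      using word_prod_scale[OF in_A[OF c(2), unfolded map_append], of "act h (\<rho> x)"] h assms(1)
      by (simp add: c eval_monomial_word_prod act_smult act_closed)
  qed
  then show ?thesis by (simp add: L.diff)
qed

lemma eval_hpoly_alternating:
  assumes "alternating_in hscale K V p" "\<sigma> permutes V" "\<And>x. \<rho> x \<in> A"
  shows "eval_hpoly (\<rho> \<circ> \<sigma>) p = scale (of_int (sign \<sigma>)) (eval_hpoly \<rho> p)"
proof -
  interpret L: Vector_Spaces.linear pscale scale "eval_hpoly \<rho>" by (rule eval_hpoly_linear)
  have "eval_hpoly \<rho> (rename_vars \<sigma> p) = eval_hpoly \<rho> (pscale (of_int (sign \<sigma>)) p)"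
    using assms by (intro eval_hpoly_eq) (auto simp: alternating_in_def)
  then show ?thesis by (simp add: eval_hpoly_rename L.scale)
qed

lemma eval_hpoly_cong:
  assumes "multilinear_hpoly K V p" "\<And>x. x \<in> V \<Longrightarrow> \<rho> x = \<rho>' x"
  shows "eval_hpoly \<rho> p = eval_hpoly \<rho>' p"
proof -
  have "eval_monomial mul act \<rho> m = eval_monomial mul act \<rho>' m" if "m \<in> Poly_Mapping.keys p" for m
  proof -
    have "\<rho> x = \<rho>' x" if "x \<in> fst ` set m" for x
      using assms that \<open>m \<in> _\<close> unfolding multilinear_hpoly_def by metis
    then have "map (\<lambda>(x, h). act h (\<rho> x)) m = map (\<lambda>(x, h). act h (\<rho>' x)) m"
      by (auto simp: rev_image_eqI)
    then show ?thesis by (simp only: eval_monomial_word_prod)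
  qed
  then show ?thesis unfolding eval_hpoly_def by (rule lin_ext_cong)
qed

text \<open>The variable \<open>x\<close> occurs exactly once in each monomial, so the value depends
  linearly on what is substituted for \<open>x\<close>. In this form, vanishing on a basis passes to
  its span, and a substituted 0 gives value 0.\<close>

lemma eval_hpoly_subspace:
  assumes p: "multilinear_hpoly K V p" and x: "x \<in> V" and \<rho>: "\<And>x. x \<in> V \<Longrightarrow> \<rho> x \<in> A"
  shows "subspace {y \<in> A. eval_hpoly (\<rho>(x := y)) p = 0}"
proof -
  have ev: "\<exists>u h w. set (u @ w) \<subseteq> A \<and> h \<in> K \<and>
      (\<forall>y. eval_monomial mul act (\<rho>(x := y)) m = word_prod mul (u @ act h y # w))"
    if m: "m \<in> Poly_Mapping.keys p" for m
  proof -
    have m: "distinct (map fst m)" "fst ` set m = V" "snd ` set m \<subseteq> K"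
      using p m by (auto simp: multilinear_hpoly_def)
    then obtain h where "(x, h) \<in> set m" using x by fastforce
    then obtain u w where uw: "m = u @ (x, h) # w" by (meson split_list)
    let ?f = "map (\<lambda>(x, h). act h (\<rho> x))"
    have "eval_monomial mul act (\<rho>(x := y)) m = word_prod mul (?f u @ act h y # ?f w)" for y
    proof -
      have "x \<notin> fst ` set (u @ w)" using m uw by auto
      then have eq: "map (\<lambda>(z, h). act h ((\<rho>(x := y)) z)) v = ?f v" if "set v \<subseteq> set (u @ w)" for v
      proof (intro map_cong refl)
        fix z assume "z \<in> set v"
        then have "fst z \<noteq> x" using that \<open>x \<notin> _\<close> by blast
        then show "(case z of (z, h) \<Rightarrow> act h ((\<rho>(x := y)) z)) = (case z of (x, h) \<Rightarrow> act h (\<rho> x))"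
          by (simp add: case_prod_unfold)
      qed
      show ?thesis
        by (simp only: uw eval_monomial_word_prod map_append list.map eq[of u] eq[of w]
            set_append Un_upper1 Un_upper2 prod.case fun_upd_same)
    qed
    moreover have "set (?f u @ ?f w) \<subseteq> A"
    proof -
      have "act h (\<rho> z) \<in> A" if "(z, h) \<in> set m" for z h
        using that m \<rho> by (intro act_closed) force+
      then show ?thesis by (auto simp: uw)
    qed
    moreover have "h \<in> K" using m uw by auto
    ultimately show ?thesis by blast
  qed
  have add: "eval_monomial mul act (\<rho>(x := y + z)) m =
      eval_monomial mul act (\<rho>(x := y)) m + eval_monomial mul act (\<rho>(x := z)) m"
    if m: "m \<in> Poly_Mapping.keys p" and "y \<in> A" "z \<in> A" for m y z
  proof -
    obtain u h w where "set (u @ w) \<subseteq> A" "h \<in> K"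
      "\<And>y. eval_monomial mul act (\<rho>(x := y)) m = word_prod mul (u @ act h y # w)"
      using ev[OF m] by blast
    then show ?thesis
      using word_prod_add[of u w "act h y" "act h z"] that by (simp add: act_add_right act_closed)
  qed
  have smult: "eval_monomial mul act (\<rho>(x := scale c y)) m =
      scale c (eval_monomial mul act (\<rho>(x := y)) m)"
    if m: "m \<in> Poly_Mapping.keys p" and "y \<in> A" for m c y
  proof -
    obtain u h w where "set (u @ w) \<subseteq> A" "h \<in> K"
      "\<And>y. eval_monomial mul act (\<rho>(x := y)) m = word_prod mul (u @ act h y # w)"
      using ev[OF m] by blast
    then show ?thesis
      using word_prod_scale[of u w "act h y"] that by (simp add: act_scale act_closed)
  qed
  have add': "eval_hpoly (\<rho>(x := y + z)) p = eval_hpoly (\<rho>(x := y)) p + eval_hpoly (\<rho>(x := z)) p"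
    if "y \<in> A" "z \<in> A" for y z
    using add[OF _ that] by (simp add: eval_hpoly_def lin_ext_def scale_right_distrib sum.distrib)
  have smult': "eval_hpoly (\<rho>(x := scale c y)) p = scale c (eval_hpoly (\<rho>(x := y)) p)"
    if "y \<in> A" for c y
    using smult[OF _ that]
    by (simp add: eval_hpoly_def lin_ext_def scale_sum_right mult.commute)
  have "eval_hpoly (\<rho>(x := 0)) p = 0"
    using smult'[of 0 0] subspace_carrier by (simp add: subspace_0)
  then show ?thesis
    using subspace_carrier by (auto simp: subspace_def add' smult')
qed

lemma eval_hpoly_zero:
  assumes "multilinear_hpoly K V p" "x \<in> V" "\<And>x. x \<in> V \<Longrightarrow> \<rho> x \<in> A" "\<rho> x = 0"
  shows "eval_hpoly \<rho> p = 0"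
proof -
  have "0 \<in> {y \<in> A. eval_hpoly (\<rho>(x := y)) p = 0}"
    by (rule subspace_0[OF eval_hpoly_subspace[OF assms(1-3)]])
  moreover have "\<rho>(x := 0) = \<rho>" using assms(4) by auto
  ultimately show ?thesis by simp
qed

end

section \<open>Ideals under a skew-primitive element\<close>

context module_algebra
begin

lemma quotient_module_algebra:
  assumes J: "invariant_ideal J" and p: "Vector_Spaces.linear scale s p"
    and ker: "\<And>a. a \<in> A \<Longrightarrow> p a = 0 \<longleftrightarrow> a \<in> J"
  obtains mul' act' where "module_algebra hscale comult counit antipode s (p ` A) mul' K act'"
    "\<And>a b. a \<in> A \<Longrightarrow> b \<in> A \<Longrightarrow> mul' (p a) (p b) = p (mul a b)"
    "\<And>h a. h \<in> K \<Longrightarrow> a \<in> A \<Longrightarrow> act' h (p a) = p (act h a)"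
proof -
  interpret p: Vector_Spaces.linear scale s p by fact
  have JA: "subspace J" "J \<subseteq> A" and ideal: "\<And>a x. a \<in> A \<Longrightarrow> x \<in> J \<Longrightarrow> mul a x \<in> J \<and> mul x a \<in> J"
    and inv: "\<And>h x. h \<in> K \<Longrightarrow> x \<in> J \<Longrightarrow> act h x \<in> J"
    using J by (auto simp: invariant_ideal_def)
  have eq_iff: "p a = p b \<longleftrightarrow> a - b \<in> J" if "a \<in> A" "b \<in> A" for a b
    using ker[of "a - b"] that subspace_carrier by (simp add: p.diff subspace_diff)
  define r where "r = inv_into A p"
  have r: "r (p a) \<in> A" "p (r (p a)) = p a" if "a \<in> A" for a
    using that by (auto simp: r_def inv_into_into f_inv_into_f)
  define mul' where "mul' x y = p (mul (r x) (r y))" for x y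
  define act' where "act' h x = p (act h (r x))" for h x
  have mul': "mul' (p a) (p b) = p (mul a b)" if ab: "a \<in> A" "b \<in> A" for a b
  proof -
    have "r (p a) - a \<in> J" "r (p b) - b \<in> J" using r eq_iff ab by auto
    moreover have "mul (r (p a)) (r (p b)) - mul a b =
        mul (r (p a) - a) (r (p b)) + mul a (r (p b) - b)"
      using r ab by (simp add: mul_diff_left mul_diff_right)
    ultimately show ?thesis
      using r ab ideal JA by (simp add: mul'_def eq_iff mul_closed subspace_add)
  qed
  have act': "act' h (p a) = p (act h a)" if "h \<in> K" "a \<in> A" for h a
  proof -
    have "act h (r (p a)) - act h a = act h (r (p a) - a)"
      using act_add_right[of h "r (p a) - a" a] that r subspace_carrier by (simp add: subspace_diff)
    moreover have "r (p a) - a \<in> J" using r eq_iff that by auto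
    ultimately show ?thesis
      using that r inv by (simp add: act'_def eq_iff act_closed)
  qed
  have "hopf_subalgebra K" by (rule hopf_subalgebra_K)
  then have K: "h + k \<in> K" "h * k \<in> K" "hscale c h \<in> K" "1 \<in> K" if "h \<in> K" "k \<in> K" for h k c
    using that by (auto simp: hopf_subalgebra_def subalgebra_def H.subspace_add H.subspace_scale)
  have A: "a + b \<in> A" "scale c a \<in> A" if "a \<in> A" "b \<in> A" for a b c
    using that subspace_carrier by (auto simp: subspace_add subspace_scale)
  have one: "1 \<in> K"
    using hopf_subalgebra_K by (auto simp: hopf_subalgebra_def subalgebra_def)
  have "module_algebra hscale comult counit antipode s (p ` A) mul' K act'"
  proof (intro module_algebra.intro assoc_algebra.intro assoc_algebra_axioms.intro module_algebra_axioms.intro)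
    show "hopf_algebra hscale comult counit antipode" by (rule hopf_algebra_axioms)
    show "vector_space s" by (rule p.vs2.vector_space_axioms)
    show "p.vs2.subspace (p ` A)" by (rule p.subspace_image) (rule subspace_carrier)
    show "hopf_subalgebra K" by (rule hopf_subalgebra_K)
    fix h t x y assume h: "h \<in> K" "sweedler K h t" and "x \<in> p ` A" "y \<in> p ` A"
    then obtain a b where ab: "x = p a" "y = p b" "a \<in> A" "b \<in> A" by auto
    have "act' h (mul' x y) = p (lin_ext scale (\<lambda>(h1, h2). mul (act h1 a) (act h2 b)) t)"
      using ab h by (simp add: mul' act' mul_closed act_mul)
    also have "\<dots> = lin_ext s (\<lambda>m. p (case m of (h1, h2) \<Rightarrow> mul (act h1 a) (act h2 b))) t"
      by (rule lin_ext_compose) (rule p)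
    also have "\<dots> = lin_ext s (\<lambda>(h1, h2). mul' (act' h1 x) (act' h2 y)) t"
      using h ab by (intro lin_ext_cong) (auto simp: sweedler_def mul' act' act_closed)
    finally show "act' h (mul' x y) = lin_ext s (\<lambda>(h1, h2). mul' (act' h1 x) (act' h2 y)) t" .
  qed (auto simp: mul' act' mul_closed act_closed K A one mul_assoc act_one act_mult
      mul_add_left mul_add_right mul_scale_left mul_scale_right act_add_left act_add_right
      act_smult act_scale simp flip: p.add p.scale)
  from that[OF this mul' act'] show ?thesis .
qed

end

locale skew_primitive_module_algebra =
  module_algebra hscale comult counit antipode scale A mul UNIV act
  for hscale :: "'f::field \<Rightarrow> 'h::ring_1 \<Rightarrow> 'h"
    and comult counit antipode
    and scale :: "'f \<Rightarrow> 'a::ab_group_add \<Rightarrow> 'a"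
    and A mul act +
  fixes Ht :: "'h set" and v g1 g2 :: 'h and \<phi> :: "'h \<Rightarrow> 'h"
  assumes hopf_sub: "hopf_subalgebra Ht"
    and generated: "subalgebra hull (Ht \<union> {v}) = UNIV"
    and g1: "g1 \<in> group_likes Ht" and g2: "g2 \<in> group_likes Ht"
    and skew_primitive: "tensor2_eq hscale (comult v) (pure (g1, v) + pure (v, g2))"
    and automorphism: "algebra_automorphism_on Ht \<phi>"
    and commutation: "h \<in> Ht \<Longrightarrow> v * h - \<phi> h * v \<in> Ht"
begin

lemma A_closed [simp]:
  "0 \<in> A" "a \<in> A \<Longrightarrow> b \<in> A \<Longrightarrow> a + b \<in> A" "a \<in> A \<Longrightarrow> b \<in> A \<Longrightarrow> a - b \<in> A" "a \<in> A \<Longrightarrow> scale c a \<in> A"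
  "a \<in> A \<Longrightarrow> b \<in> A \<Longrightarrow> mul a b \<in> A" "a \<in> A \<Longrightarrow> act h a \<in> A"
  using subspace_carrier
  by (auto simp: subspace_0 subspace_add subspace_diff subspace_scale mul_closed act_closed)

lemma act_0: "act h 0 = 0"
  using act_scale[of h 0 0] by simp

lemma act_diff: "a \<in> A \<Longrightarrow> b \<in> A \<Longrightarrow> act h (a - b) = act h a - act h b"
  using act_add_right[of h "a - b" b] by simp

lemma linear_on_sum:
  assumes "\<And>i. i \<in> S \<Longrightarrow> x i \<in> A"
  shows "act h (\<Sum>i\<in>S. scale (u i) (x i)) = (\<Sum>i\<in>S. scale (u i) (act h (x i)))"
  using assms
proof (induction S rule: infinite_finite_induct)
  case (insert i S)
  have "(\<Sum>i\<in>S. scale (u i) (x i)) \<in> A"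
    using insert.prems subspace_carrier by (intro subspace_sum) auto
  with insert show ?case by (simp add: act_add_right act_scale)
qed (auto simp: act_0)

lemma act_v_mul:
  assumes "a \<in> A" "b \<in> A"
  shows "act v (mul a b) = mul (act g1 a) (act v b) + mul (act v a) (act g2 b)"
proof -
  interpret L: Vector_Spaces.linear pscale scale "lin_ext scale (\<lambda>(h1, h2). mul (act h1 a) (act h2 b))"
    by (rule linear_lin_ext) (rule vector_space_axioms)
  have "sweedler UNIV v (pure (g1, v) + pure (v, g2))"
    using skew_primitive by (simp add: sweedler_def)
  from act_mul[OF _ this assms] show ?thesis
    by (simp add: L.add vector_space_axioms)
qed

lemma act_group_like_mul:
  assumes "g \<in> group_likes Ht" "a \<in> A" "b \<in> A"
  shows "act g (mul a b) = mul (act g a) (act g b)"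
proof -
  have "sweedler UNIV g (pure (g, g))"
    using assms by (simp add: sweedler_def group_likes_def)
  from act_mul[OF _ this assms(2,3)] show ?thesis
    by (simp add: vector_space_axioms)
qed

lemma act_group_like_inverse:
  assumes "g \<in> group_likes Ht" "a \<in> A"
  shows "act g (act (antipode g) a) = a" "act (antipode g) (act g a) = a"
  using group_like_inverse[OF assms(1)] assms(2)
  by (simp_all add: act_mult[symmetric] act_one)

lemma group_like_in:
  assumes "g \<in> group_likes Ht"
  shows "g \<in> Ht" "antipode g \<in> Ht"
  using assms hopf_sub by (auto simp: group_likes_def hopf_subalgebra_def)

text \<open>Restriction of the action to \<open>Ht\<close>: a representative of the coproduct with
  components in \<open>Ht\<close> is in particular one with components in \<open>H\<close>, so the
  product rule is inherited.\<close>

sublocale R: module_algebra hscale comult counit antipode scale A mul Ht act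
proof unfold_locales
  show "hopf_subalgebra Ht" by (rule hopf_sub)
  show "act h (mul a b) = lin_ext scale (\<lambda>(h1, h2). mul (act h1 a) (act h2 b)) t"
    if "sweedler Ht h t" "a \<in> A" "b \<in> A" for h t a b
    by (rule act_mul) (use that in \<open>auto simp: sweedler_def\<close>)
qed (auto simp: act_add_left act_add_right act_smult act_scale act_one act_mult)

lemma ideal_simps:
  assumes "R.invariant_ideal L"
  shows "subspace L" "L \<subseteq> A" "x \<in> L \<Longrightarrow> x \<in> A" "0 \<in> L" "x \<in> L \<Longrightarrow> y \<in> L \<Longrightarrow> x + y \<in> L"
    "x \<in> L \<Longrightarrow> y \<in> L \<Longrightarrow> x - y \<in> L" "x \<in> L \<Longrightarrow> scale c x \<in> L"
    "a \<in> A \<Longrightarrow> x \<in> L \<Longrightarrow> mul a x \<in> L" "a \<in> A \<Longrightarrow> x \<in> L \<Longrightarrow> mul x a \<in> L"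
    "h \<in> Ht \<Longrightarrow> x \<in> L \<Longrightarrow> act h x \<in> L"
  using assms
  by (auto simp: R.invariant_ideal_def subspace_0 subspace_add subspace_diff subspace_scale)

lemma R_invariant_idealI:
  assumes "L \<subseteq> A" "0 \<in> L" "\<And>x y. x \<in> L \<Longrightarrow> y \<in> L \<Longrightarrow> x + y \<in> L" "\<And>c x. x \<in> L \<Longrightarrow> scale c x \<in> L"
    "\<And>a x. a \<in> A \<Longrightarrow> x \<in> L \<Longrightarrow> mul a x \<in> L" "\<And>a x. a \<in> A \<Longrightarrow> x \<in> L \<Longrightarrow> mul x a \<in> L"
    "\<And>h x. h \<in> Ht \<Longrightarrow> x \<in> L \<Longrightarrow> act h x \<in> L"
  shows "R.invariant_ideal L"
  using assms by (auto simp: R.invariant_ideal_def subspace_def)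

text \<open>In \<open>v (a y) = (g1 a) (v y) + (v a) (g2 y)\<close> the first term lies in
  \<open>L\<close> because \<open>v y\<close> does, the second because \<open>g2 y\<close> is in
  \<open>V \<subseteq> L\<close>; products from the other side are symmetric. For the action of
  \<open>Ht\<close>, \<open>v h\<close> is \<open>\<phi> h v\<close> plus an element of
  \<open>Ht\<close>, which again maps \<open>V\<close> into \<open>L\<close>.\<close>

lemma pullback_ideal:
  assumes V: "R.invariant_ideal V" and L: "R.invariant_ideal L" and "V \<subseteq> L"
  shows "R.invariant_ideal {y \<in> V. act v y \<in> L}"
proof (rule R_invariant_idealI)
  note s = ideal_simps[OF V] and t = ideal_simps[OF L]
  show "{y \<in> V. act v y \<in> L} \<subseteq> A" using s by auto
  fix a y assume a: "a \<in> A" and y: "y \<in> {y \<in> V. act v y \<in> L}"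
  have y: "y \<in> V" "y \<in> A" "act v y \<in> L" using y s by auto
  have "act g1 y \<in> L" "act g2 y \<in> L"
    using s(10) y group_like_in(1)[OF g1] group_like_in(1)[OF g2] \<open>V \<subseteq> L\<close> by auto
  then have "act v (mul a y) \<in> L" "act v (mul y a) \<in> L"
    using y a by (auto simp: act_v_mul intro!: t(5) intro: t(8,9))
  then show "mul a y \<in> {y \<in> V. act v y \<in> L}" "mul y a \<in> {y \<in> V. act v y \<in> L}"
    using y a s(8,9) by auto
next
  note s = ideal_simps[OF V] and t = ideal_simps[OF L]
  fix h y assume h: "h \<in> Ht" and y: "y \<in> {y \<in> V. act v y \<in> L}"
  have "act v (act h y) = act (\<phi> h * v + (v * h - \<phi> h * v)) y"
    using y s(3) by (simp add: act_mult)
  also have "\<dots> = act (\<phi> h) (act v y) + act (v * h - \<phi> h * v) y"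
    using y s(3) by (subst act_add_left) (auto simp: act_mult)
  also have "\<dots> \<in> L"
    using h y commutation automorphism \<open>V \<subseteq> L\<close>
    by (auto simp: algebra_automorphism_on_def bij_betw_def intro!: t)
  finally show "act h y \<in> {y \<in> V. act v y \<in> L}" using h y s by auto
next
  note s = ideal_simps[OF V] and t = ideal_simps[OF L]
  show "0 \<in> {y \<in> V. act v y \<in> L}" using s t by (simp add: act_0)
  show "x + y \<in> {y \<in> V. act v y \<in> L}" if "x \<in> {y \<in> V. act v y \<in> L}" "y \<in> {y \<in> V. act v y \<in> L}" for x y
    using that s t by (auto simp: act_add_right)
  show "scale c x \<in> {y \<in> V. act v y \<in> L}" if "x \<in> {y \<in> V. act v y \<in> L}" for c x
    using that s t by (auto simp: act_scale)
qed

definition extend_ideal :: "'a set \<Rightarrow> 'a set \<Rightarrow> 'a set" where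
  "extend_ideal I V = {x + act v y | x y. x \<in> I \<and> y \<in> V}"

lemma extend_ideal_mono: "V \<subseteq> V' \<Longrightarrow> extend_ideal I V \<subseteq> extend_ideal I V'"
  by (auto simp: extend_ideal_def)

lemma in_extend_ideal:
  assumes "R.invariant_ideal I" "R.invariant_ideal V"
  shows "x \<in> I \<Longrightarrow> x \<in> extend_ideal I V" "y \<in> V \<Longrightarrow> act v y \<in> extend_ideal I V"
proof -
  have "x = x + act v 0" "act v y = 0 + act v y" by (simp_all add: act_0)
  then show "x \<in> I \<Longrightarrow> x \<in> extend_ideal I V" "y \<in> V \<Longrightarrow> act v y \<in> extend_ideal I V"
    unfolding extend_ideal_def using ideal_simps(4)[OF assms(1)] ideal_simps(4)[OF assms(2)] by blast+
qed

text \<open>Since the group-likes act invertibly, the twisted Leibniz rule for \<open>v\<close> expresses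
  \<open>a (v y)\<close> and \<open>(v y) a\<close> through \<open>v (a' y)\<close> and \<open>v (y a')\<close> modulo \<open>V\<close>.\<close>

lemma extend_ideal_invariant:
  assumes I: "R.invariant_ideal I" and V: "R.invariant_ideal V" and sub: "V \<subseteq> extend_ideal I V"
  shows "R.invariant_ideal (extend_ideal I V)"
proof -
  note s = ideal_simps[OF I] and t = ideal_simps[OF V]
  let ?W = "extend_ideal I V"
  have add: "z + w \<in> ?W" if z: "z \<in> ?W" and w: "w \<in> ?W" for z w
  proof -
    obtain x y where "z = x + act v y" "x \<in> I" "y \<in> V"
      using z by (auto simp: extend_ideal_def)
    moreover obtain x' y' where "w = x' + act v y'" "x' \<in> I" "y' \<in> V"
      using w by (auto simp: extend_ideal_def)
    ultimately have "z + w = (x + x') + act v (y + y')" "x + x' \<in> I" "y + y' \<in> V"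
      using s t by (auto simp: act_add_right)
    then show ?thesis unfolding extend_ideal_def by blast
  qed
  have smult: "scale c z \<in> ?W" if z: "z \<in> ?W" for z c
  proof -
    obtain x y where "z = x + act v y" "x \<in> I" "y \<in> V"
      using z by (auto simp: extend_ideal_def)
    then have "scale c z = scale c x + act v (scale c y)" "scale c x \<in> I" "scale c y \<in> V"
      using s t by (auto simp: act_scale scale_right_distrib)
    then show ?thesis unfolding extend_ideal_def by blast
  qed
  have diff: "z - w \<in> ?W" if "z \<in> ?W" "w \<in> ?W" for z w
    using add[OF that(1) smult[OF that(2), of "- 1"]] by simp
  note W = in_extend_ideal[OF I V]
  show ?thesis
  proof (rule R_invariant_idealI)
    show "?W \<subseteq> A" using s t by (auto simp: extend_ideal_def)
    show "0 \<in> ?W" using W s by auto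
    fix a z assume a: "a \<in> A" and "z \<in> ?W"
    then obtain x y where z: "z = x + act v y" "x \<in> I" "y \<in> V"
      by (auto simp: extend_ideal_def)
    have yA: "y \<in> A" and xA: "x \<in> A" using z s t by auto
    have "mul a (act v y) \<in> ?W"
    proof -
      let ?b = "act (antipode g1) a"
      have "mul a (act v y) = act v (mul ?b y) - mul (act v ?b) (act g2 y)"
        using a yA by (simp add: act_v_mul act_group_like_inverse[OF g1])
      moreover have "mul ?b y \<in> V" "mul (act v ?b) (act g2 y) \<in> V"
        using a z t group_like_in[OF g2] by auto
      ultimately show ?thesis using diff W sub by auto
    qed
    moreover have "mul a x \<in> ?W" using W s z a by auto
    ultimately show "mul a z \<in> ?W" using a xA yA z add by (simp add: mul_add_right)
    have "mul (act v y) a \<in> ?W"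
    proof -
      let ?b = "act (antipode g2) a"
      have "mul (act v y) a = act v (mul y ?b) - mul (act g1 y) (act v ?b)"
        using a yA by (simp add: act_v_mul act_group_like_inverse[OF g2])
      moreover have "mul y ?b \<in> V" "mul (act g1 y) (act v ?b) \<in> V"
        using a z t group_like_in[OF g1] by auto
      ultimately show ?thesis using diff W sub by auto
    qed
    moreover have "mul x a \<in> ?W" using W s z a by auto
    ultimately show "mul z a \<in> ?W" using a xA yA z add by (simp add: mul_add_left)
  next
    fix h z assume h: "h \<in> Ht" and "z \<in> ?W"
    then obtain x y where z: "z = x + act v y" "x \<in> I" "y \<in> V"
      by (auto simp: extend_ideal_def)
    have yA: "y \<in> A" and xA: "x \<in> A" using z s t by auto
    \<comment> \<open>Surjectivity of \<open>\<phi>\<close> lets \<open>h\<close> pass to the right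
      of \<open>v\<close>: \<open>h (v y)\<close> is \<open>v (k y)\<close> up to an element of
      \<open>Ht\<close> applied to \<open>y\<close>, which stays in \<open>V\<close>.\<close>
    obtain k where k: "k \<in> Ht" "h = \<phi> k"
      using h automorphism by (metis algebra_automorphism_on_def bij_betw_imp_surj_on imageE)
    have "act v (act k y) = act (\<phi> k * v + (v * k - \<phi> k * v)) y"
      using yA by (simp add: act_mult)
    also have "\<dots> = act h (act v y) + act (v * k - \<phi> k * v) y"
      using yA by (subst act_add_left) (auto simp: act_mult k)
    finally have "act h (act v y) = act v (act k y) - act (v * k - \<phi> k * v) y" by simp
    moreover have "act k y \<in> V" "act (v * k - \<phi> k * v) y \<in> V"
      using z t k commutation by auto
    ultimately have "act h (act v y) \<in> ?W" using diff W sub by auto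
    moreover have "act h x \<in> ?W" using W s z h by auto
    ultimately show "act h z \<in> ?W" using xA yA z add by (simp add: act_add_right)
  qed (use add smult in auto)
qed

text \<open>The elements of \<open>H\<close> that preserve \<open>L\<close> form a subalgebra; it
  contains \<open>Ht\<close> and \<open>v\<close>, hence everything they generate.\<close>

lemma invariant_idealI:
  assumes L: "R.invariant_ideal L" and v: "\<And>x. x \<in> L \<Longrightarrow> act v x \<in> L"
  shows "invariant_ideal L"
proof -
  note s = ideal_simps[OF L]
  let ?S = "{h. \<forall>x\<in>L. act h x \<in> L}"
  have "subalgebra ?S"
  proof -
    have "act 0 x = 0" if "x \<in> L" for x
      using act_smult[of 0 x 0] s(3) that by simp
    then show ?thesis
      using s(3-7)
      by (auto simp: subalgebra_def H.subspace_def act_add_left act_smult act_one act_mult)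
  qed
  moreover have "Ht \<union> {v} \<subseteq> ?S" using s v by auto
  ultimately have "subalgebra hull (Ht \<union> {v}) \<subseteq> ?S" by (intro hull_minimal)
  then have "act h x \<in> L" if "x \<in> L" for h x using generated that by auto
  then show ?thesis
    using s by (auto simp: invariant_ideal_def)
qed

text \<open>The sum \<open>I + v I + ...\<close> in Horner form, so that each step applies
  \<open>v\<close> only once. Starting from \<open>{0}\<close> makes the index count the
  layers.\<close>

primrec ideal_chain :: "'a set \<Rightarrow> nat \<Rightarrow> 'a set" where
  "ideal_chain I 0 = {0}"
| "ideal_chain I (Suc k) = extend_ideal I (ideal_chain I k)"

text \<open>The two claims need a joint induction: invariance of the next ideal requires that it
  contains the present one, which monotonicity of \<open>extend_ideal\<close> carries along.\<close>

lemma ideal_chain_invariant: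
  assumes I: "R.invariant_ideal I"
  shows "R.invariant_ideal (ideal_chain I k)" "ideal_chain I k \<subseteq> ideal_chain I (Suc k)"
proof (induction k)
  case 0
  have zero: "R.invariant_ideal {0}"
    by (rule R_invariant_idealI) (auto simp: act_0 mul_0_left mul_0_right)
  {
    case 1
    show ?case using zero by simp
  next
    case 2
    show ?case using in_extend_ideal(1)[OF I zero] ideal_simps(4)[OF I] by simp
  }
next
  case (Suc k)
  {
    case 1
    show ?case using extend_ideal_invariant[OF I Suc.IH(1)] Suc.IH(2) by simp
  next
    case 2
    show ?case using extend_ideal_mono[OF Suc.IH(2)] by simp
  }
qed

end

section \<open>The chain of ideals of a simple algebra\<close>

locale simple_chain =
  skew_primitive_module_algebra hscale comult counit antipode scale A mul act Ht v g1 g2 \<phi>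
  for hscale :: "'f::field \<Rightarrow> 'h::ring_1 \<Rightarrow> 'h"
    and comult counit antipode
    and scale :: "'f \<Rightarrow> 'a::ab_group_add \<Rightarrow> 'a"
    and A mul act Ht v g1 g2 \<phi> +
  fixes I :: "'a set" and T :: nat
  assumes finite_dim: finite_dimensional and simple: simple
    and I: "R.invariant_ideal I" and I_nonzero: "I \<noteq> {0}"
    and I_minimal: "\<lbrakk>R.invariant_ideal L; L \<subseteq> I\<rbrakk> \<Longrightarrow> L = {0} \<or> L = I"
    and chain_top: "ideal_chain I (Suc T) = A" and chain_proper: "ideal_chain I T \<noteq> A"

text \<open>A nonzero \<open>Ht\<close>-ideal of least dimension is minimal. If two consecutive
  members of the chain agree, that member is stable under \<open>v\<close>, hence an
  \<open>H\<close>-ideal containing \<open>I\<close>, hence \<open>A\<close>. Otherwise the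
  dimensions would grow forever inside a finite dimensional space.\<close>

lemma (in skew_primitive_module_algebra) simple_chain_exists:
  assumes fd: finite_dimensional and simple: simple
  obtains I T where
    "simple_chain hscale comult counit antipode scale A mul act Ht v g1 g2 \<phi> I T"
proof -
  obtain B where B: "finite B" "B \<subseteq> A" "span B = A"
    using fd by (auto simp: finite_dimensional_def)
  have "A \<noteq> {0}"
  proof
    assume "A = {0}"
    then have "{mul a b |a b. a \<in> A \<and> b \<in> A} \<subseteq> {0}" by (auto simp: mul_0_left)
    then have "span {mul a b |a b. a \<in> A \<and> b \<in> A} \<subseteq> {0}" by (rule span_minimal) simp
    then show False using simple span_zero unfolding simple_def by blast
  qed
  moreover have "R.invariant_ideal A"
    by (rule R_invariant_idealI) auto
  ultimately obtain I where I: "R.invariant_ideal I \<and> I \<noteq> {0}"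
    and min: "\<And>L. R.invariant_ideal L \<and> L \<noteq> {0} \<Longrightarrow> dim I \<le> dim L"
    using ex_has_least_nat[of "\<lambda>I. R.invariant_ideal I \<and> I \<noteq> {0}" A dim] by blast
  have I_ideal: "R.invariant_ideal I" using I by simp
  let ?W = "ideal_chain I"
  note W = ideal_chain_invariant[OF I_ideal]
  have IW: "I \<subseteq> ?W (Suc k)" for k
    using in_extend_ideal(1)[OF I_ideal W(1)] by auto
  have "\<exists>k. ?W k = A"
  proof (rule ccontr)
    assume neq: "\<not> (\<exists>k. ?W k = A)"
    have strict: "?W k \<subset> ?W (Suc k)" for k
    proof (rule ccontr)
      assume "\<not> ?W k \<subset> ?W (Suc k)"
      then have eq: "?W (Suc k) = ?W k" using W(2) by auto
      then have "invariant_ideal (?W k)"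
        using in_extend_ideal(2)[OF I_ideal W(1), of _ k] by (intro invariant_idealI W) auto
      moreover have "?W k \<noteq> {0}" using IW[of k] I eq ideal_simps(4)[OF I_ideal] by auto
      ultimately show False using simple neq by (auto simp: simple_def)
    qed
    have sub: "subspace (?W k)" "?W k \<subseteq> span B" for k
      using ideal_simps(1,2)[OF W(1)[of k]] B by auto
    have "k \<le> dim (?W k)" for k
    proof (induction k)
      case (Suc k)
      have "dim (?W k) < dim (?W (Suc k))"
        using dim_psubset_subspace[OF B(1) sub(1) sub(1) strict sub(2)] .
      with Suc show ?case by simp
    qed simp
    moreover have "dim (?W k) \<le> card B" for k
      using dim_le_card[OF sub(2) B(1)] .
    ultimately show False using not_less_eq_eq le_trans by blast
  qed
  then have least: "?W (LEAST k. ?W k = A) = A" by (rule LeastI_ex)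
  \<comment> \<open>The least index is a successor because the chain starts with \<open>{0}\<close>
    and \<open>A\<close> is nonzero.\<close>
  then obtain T where T: "(LEAST k. ?W k = A) = Suc T"
    using \<open>A \<noteq> {0}\<close> by (cases "LEAST k. ?W k = A") auto
  have proper: "?W T \<noteq> A" using not_less_Least[of T "\<lambda>k. ?W k = A"] T by auto
  have "simple_chain hscale comult counit antipode scale A mul act Ht v g1 g2 \<phi> I T"
  proof unfold_locales
    fix L assume L: "R.invariant_ideal L" "L \<subseteq> I"
    show "L = {0} \<or> L = I"
    proof (rule ccontr)
      assume "\<not> (L = {0} \<or> L = I)"
      then have "L \<subset> I" "dim I \<le> dim L" using L min by auto
      moreover have "dim L < dim I"
        using ideal_simps[OF L(1)] ideal_simps[OF I_ideal] B \<open>L \<subset> I\<close> by (intro dim_psubset_subspace[of B]) auto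
      ultimately show False by simp
    qed
  qed (use fd simple I least T proper in auto)
  then show ?thesis by (rule that)
qed

context simple_chain
begin

abbreviation W :: "nat \<Rightarrow> 'a set" where "W \<equiv> ideal_chain I"

lemma W_Suc: "W (Suc k) = extend_ideal I (W k)" by simp

declare ideal_chain.simps(2) [simp del]

lemmas W_ideal = ideal_chain_invariant(1)[OF I]

lemmas W_simps = ideal_simps[OF W_ideal] and I_simps = ideal_simps[OF I]

lemma W_mono: "i \<le> j \<Longrightarrow> W i \<subseteq> W j"
  by (rule lift_Suc_mono_le[of W]) (rule ideal_chain_invariant(2)[OF I])

lemma act_v_W: "y \<in> W k \<Longrightarrow> act v y \<in> W (Suc k)"
  using in_extend_ideal(2)[OF I W_ideal] by (simp add: W_Suc)

lemma I_subset_W: "x \<in> I \<Longrightarrow> x \<in> W (Suc k)"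
  using in_extend_ideal(1)[OF I W_ideal] by (simp add: W_Suc)

lemma W_1: "W (Suc 0) = I"
  by (auto simp: W_Suc extend_ideal_def act_0)

lemma W_strict: "k \<le> T \<Longrightarrow> \<not> W (Suc k) \<subseteq> W k"
proof
  assume k: "k \<le> T" and sub: "W (Suc k) \<subseteq> W k"
  then have "invariant_ideal (W k)"
    using act_v_W by (intro invariant_idealI W_ideal) auto
  then have "W k = {0} \<or> W k = A" using simple by (auto simp: simple_def)
  moreover have "W k \<noteq> {0}" using I_subset_W I_nonzero I_simps(4) sub by blast
  moreover have "W k \<noteq> A" using W_mono[OF k] chain_proper W_simps(2)[of T] by blast
  ultimately show False by simp
qed

text \<open>The set \<open>?M\<close> of elements of \<open>W (k + 1)\<close> that \<open>v\<close>
  sends into \<open>L\<close> is an \<open>Ht\<close>-ideal above \<open>W k\<close>, so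
  irreducibility of the lower factor leaves two cases. Either \<open>?M\<close> is
  \<open>W k\<close>, and then \<open>L\<close> has collapsed to \<open>W (k + 1)\<close>, or
  \<open>L\<close> contains \<open>v W (k + 1)\<close> and is everything. The second conclusion is
  the injectivity of \<open>v\<close> from one factor to the next: for \<open>L = W (k + 1)\<close>
  strictness of the chain rules out the second case.\<close>

lemma act_v_kernel_if_irreducible:
  assumes irr: "\<And>L. R.invariant_ideal L \<Longrightarrow> W k \<subseteq> L \<Longrightarrow> L \<subseteq> W (Suc k) \<Longrightarrow> L = W k \<or> L = W (Suc k)"
    and L: "R.invariant_ideal L" "W (Suc k) \<subseteq> L" "L \<subseteq> W (Suc (Suc k))"
  shows "L = W (Suc k) \<or> L = W (Suc (Suc k))"
    "L = W (Suc k) \<Longrightarrow> k < T \<Longrightarrow> y \<in> W (Suc k) \<Longrightarrow> act v y \<in> L \<Longrightarrow> y \<in> W k"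
proof -
  let ?M = "{y \<in> W (Suc k). act v y \<in> L}"
  have "?M = W k \<or> ?M = W (Suc k)"
  proof (rule irr)
    show "R.invariant_ideal ?M" by (rule pullback_ideal[OF W_ideal L(1,2)])
    show "W k \<subseteq> ?M" using act_v_W L(2) W_mono[of k "Suc k"] by auto
  qed auto
  then consider (low) "?M = W k" | (high) "?M = W (Suc k)" by blast
  then have *: "(L = W (Suc k) \<and> ?M = W k) \<or> L = W (Suc (Suc k))"
  proof cases
    case low
    have "z \<in> W (Suc k)" if z: "z \<in> L" for z
    proof -
      obtain x y where xy: "z = x + act v y" "x \<in> I" "y \<in> W (Suc k)"
        using z L(3) unfolding W_Suc[of "Suc k"] extend_ideal_def by blast
      have "act v y = z - x" using xy by simp
      also have "\<dots> \<in> L"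
        using z xy(2) I_subset_W L(2) by (intro ideal_simps(6)[OF L(1)]) auto
      finally have "y \<in> W k" using low xy by blast
      then show ?thesis using xy by (auto simp: W_Suc extend_ideal_def)
    qed
    with low L show ?thesis by auto
  next
    case high
    have "x + act v y \<in> L" if "x \<in> I" "y \<in> W (Suc k)" for x y
    proof (rule ideal_simps(5)[OF L(1)])
      show "x \<in> L" using that I_subset_W L(2) by blast
      show "act v y \<in> L" using that high by blast
    qed
    then have "W (Suc (Suc k)) \<subseteq> L" unfolding W_Suc[of "Suc k"] extend_ideal_def by auto
    with L show ?thesis by auto
  qed
  then show "L = W (Suc k) \<or> L = W (Suc (Suc k))" by auto
  show "y \<in> W k" if "L = W (Suc k)" "k < T" "y \<in> W (Suc k)" "act v y \<in> L"
    using * that W_strict[of "Suc k"] by auto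
qed

lemma W_irreducible:
  "\<lbrakk>R.invariant_ideal L; W k \<subseteq> L; L \<subseteq> W (Suc k)\<rbrakk> \<Longrightarrow> L = W k \<or> L = W (Suc k)"
proof (induction k arbitrary: L)
  case 0
  then show ?case using I_minimal[of L] unfolding W_1 by auto
next
  case (Suc k)
  show ?case by (rule act_v_kernel_if_irreducible(1)[OF Suc.IH Suc.prems])
qed

lemma act_v_kernel: "\<lbrakk>k < T; y \<in> W (Suc k); act v y \<in> W (Suc k)\<rbrakk> \<Longrightarrow> y \<in> W k"
  using W_mono[of "Suc k" "Suc (Suc k)"]
  by (intro act_v_kernel_if_irreducible(2)[OF W_irreducible W_ideal[of "Suc k"], of k]) auto

section \<open>Lifting the unit of the top factor\<close>

definition unit_mod :: "'a \<Rightarrow> bool" where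
  "unit_mod e \<longleftrightarrow> e \<in> A \<and> (\<forall>a\<in>A. mul e a - a \<in> W T \<and> mul a e - a \<in> W T)"

text \<open>A group-like element acts as an invertible algebra endomorphism of \<open>A\<close> that
  preserves \<open>W T\<close>. Applying \<open>g\<close> to the defect of \<open>e\<close> at the
  preimage \<open>?b\<close> of \<open>a\<close> gives the defect of \<open>g e\<close> at
  \<open>a\<close>.\<close>

lemma unit_mod_group_like:
  assumes g: "g \<in> group_likes Ht" and e: "unit_mod e"
  shows "unit_mod (act g e)"
  unfolding unit_mod_def
proof (intro conjI ballI)
  show "act g e \<in> A" using e by (simp add: unit_mod_def)
  fix a assume a: "a \<in> A"
  let ?b = "act (antipode g) a"
  have b: "?b \<in> A" "mul e ?b - ?b \<in> W T" "mul ?b e - ?b \<in> W T" "e \<in> A"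
    using e a by (auto simp: unit_mod_def)
  have "act g (mul e ?b - ?b) = mul (act g e) a - a" "act g (mul ?b e - ?b) = mul a (act g e) - a"
    using b a by (simp_all add: act_diff act_group_like_mul[OF g] act_group_like_inverse[OF g])
  then show "mul (act g e) a - a \<in> W T" "mul a (act g e) - a \<in> W T"
    using W_simps(10)[OF group_like_in(1)[OF g] b(2)] W_simps(10)[OF group_like_in(1)[OF g] b(3)] by auto
qed

text \<open>A lift of the unit of \<open>A / W T\<close> acts as the identity on every factor \<open>W (k + 1) / W k\<close>,
  because \<open>v\<close> embeds each factor into the next one up to a twist by \<open>g1\<close> and \<open>g2\<close>.\<close>

lemma unit_mod_factor:
  assumes "k \<le> T" "unit_mod e" "y \<in> W (Suc k)"
  shows "mul e y - y \<in> W k \<and> mul y e - y \<in> W k"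
  using assms
\<comment> \<open>Downward induction from the top factor. The lift \<open>e\<close> must be general
  because the Leibniz rule for \<open>v\<close> replaces it by \<open>g1 e\<close> or
  \<open>g2 e\<close>.\<close>
proof (induction k arbitrary: e y rule: inc_induct)
  case base
  then show ?case using chain_top by (auto simp: unit_mod_def)
next
  case (step k)
  have e: "e \<in> A" using step.prems by (simp add: unit_mod_def)
  have y: "y \<in> A" using W_simps(3) step.prems by blast
  have vy: "act v y \<in> W (Suc (Suc k))" using act_v_W step.prems by blast
  have IH: "mul (act g e) (act v y) - act v y \<in> W (Suc k)"
    "mul (act v y) (act g e) - act v y \<in> W (Suc k)" if "g \<in> group_likes Ht" for g
    using step.IH[OF unit_mod_group_like[OF that step.prems(1)] vy] by auto
  have gy: "act g1 y \<in> W (Suc k)" "act g2 y \<in> W (Suc k)"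
    using W_simps(10)[OF _ step.prems(2)] group_like_in[OF g1] group_like_in[OF g2] by auto
  have "act v (mul e y - y) = (mul (act g1 e) (act v y) - act v y) + mul (act v e) (act g2 y)"
    using e y by (simp add: act_diff act_v_mul)
  also have "\<dots> \<in> W (Suc k)"
    using IH(1)[OF g1] W_simps(8)[OF _ gy(2), of "act v e"] e by (intro W_simps(5)) auto
  finally have 1: "act v (mul e y - y) \<in> W (Suc k)" .
  have "act v (mul y e - y) = mul (act g1 y) (act v e) + (mul (act v y) (act g2 e) - act v y)"
    using e y by (simp add: act_diff act_v_mul)
  also have "\<dots> \<in> W (Suc k)"
    using IH(2)[OF g2] W_simps(9)[OF _ gy(1), of "act v e"] e by (intro W_simps(5)) auto
  finally have 2: "act v (mul y e - y) \<in> W (Suc k)" .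
  have "mul e y - y \<in> W (Suc k)" "mul y e - y \<in> W (Suc k)"
    using W_simps(6,8,9) e step.prems by auto
  then show ?case using act_v_kernel[OF step.hyps(2)] 1 2 by blast
qed

text \<open>The iteration \<open>u \<mapsto> e + u - e u\<close> multiplies the defect \<open>u a - a\<close> by \<open>1 - e\<close>.\<close>

lemma unital_if_unit_mod:
  assumes e: "unit_mod e"
  shows unital
proof -
  have eA: "e \<in> A" using e by (simp add: unit_mod_def)
  \<comment> \<open>The iteration starts at \<open>u = 0\<close>, whose defect lies in
    \<open>W (T + 1) = A\<close>. Each step lowers the level by one, so after \<open>T + 1\<close>
    steps the defect lies in \<open>W 0 = {0}\<close>.\<close>
  have "\<exists>u\<in>A. \<forall>a\<in>A. mul u a - a \<in> W (Suc T - n)" if "n \<le> Suc T" for n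
    using that
  proof (induction n)
    case 0
    show ?case by (rule bexI[of _ 0]) (use A_closed(3)[of 0] in \<open>auto simp: mul_0_left chain_top\<close>)
  next
    case (Suc n)
    then obtain u where u: "u \<in> A" "\<And>a. a \<in> A \<Longrightarrow> mul u a - a \<in> W (Suc T - n)" by auto
    let ?u = "e + u - mul e u"
    have "mul ?u a - a \<in> W (Suc T - Suc n)" if a: "a \<in> A" for a
    proof -
      let ?d = "mul u a - a"
      have "?d \<in> W (Suc (T - n))" using u(2)[OF a] Suc.prems by (simp add: Suc_diff_le)
      then have "mul e ?d - ?d \<in> W (T - n)"
        using unit_mod_factor[of "T - n" e ?d] e by auto
      then have "0 - (mul e ?d - ?d) \<in> W (T - n)" by (rule W_simps(6)[OF W_simps(4)])
      moreover have "mul ?u a - a = 0 - (mul e ?d - ?d)"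
        using a u eA by (simp add: mul_add_left mul_diff_left mul_diff_right mul_assoc)
      ultimately show ?thesis by (simp only: diff_Suc_Suc)
    qed
    moreover have "?u \<in> A" using u eA by simp
    ultimately show ?case by blast
  qed
  from this[of "Suc T"] obtain u where u: "u \<in> A" "\<And>a. a \<in> A \<Longrightarrow> mul u a = a" by auto
  have "\<exists>u\<in>A. \<forall>a\<in>A. mul a u - a \<in> W (Suc T - n)" if "n \<le> Suc T" for n
    using that
  proof (induction n)
    case 0
    show ?case by (rule bexI[of _ 0]) (use A_closed(3)[of 0] in \<open>auto simp: mul_0_right chain_top\<close>)
  next
    case (Suc n)
    then obtain u where u: "u \<in> A" "\<And>a. a \<in> A \<Longrightarrow> mul a u - a \<in> W (Suc T - n)" by auto
    let ?u = "e + u - mul u e"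
    have "mul a ?u - a \<in> W (Suc T - Suc n)" if a: "a \<in> A" for a
    proof -
      let ?d = "mul a u - a"
      have "?d \<in> W (Suc (T - n))" using u(2)[OF a] Suc.prems by (simp add: Suc_diff_le)
      then have "mul ?d e - ?d \<in> W (T - n)"
        using unit_mod_factor[of "T - n" e ?d] e by auto
      then have "0 - (mul ?d e - ?d) \<in> W (T - n)" by (rule W_simps(6)[OF W_simps(4)])
      moreover have "mul a ?u - a = 0 - (mul ?d e - ?d)"
        using a u eA by (simp add: mul_add_right mul_diff_left mul_diff_right mul_assoc)
      ultimately show ?thesis by (simp only: diff_Suc_Suc)
    qed
    moreover have "?u \<in> A" using u eA by simp
    ultimately show ?case by blast
  qed
  from this[of "Suc T"] obtain w where w: "w \<in> A" "\<And>a. a \<in> A \<Longrightarrow> mul a w = a" by auto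
  have "u = w" using u(2)[OF w(1)] w(2)[OF u(1)] by simp
  then show ?thesis using u w by (auto simp: unital_def)
qed

end

section \<open>Alternation\<close>

lemma sum_lessThan_add:
  fixes f :: "nat \<Rightarrow> 'a::comm_monoid_add"
  shows "(\<Sum>r<m + n. f r) = (\<Sum>r<m. f r) + (\<Sum>r<n. f (m + r))"
  by (induction n) (simp_all add: add.assoc)

lemma (in vector_space) independent_list_coeffs:
  assumes "distinct xs" "independent (set xs)" "(\<Sum>j<length xs. scale (u j) (xs ! j)) = 0" "j < length xs"
  shows "u j = 0"
proof -
  have bij: "bij_betw ((!) xs) {..<length xs} (set xs)"
    by (rule bij_betw_nth) (use assms in auto)
  define w where "w x = u (the_inv_into {..<length xs} ((!) xs) x)" for x
  have w: "w (xs ! j) = u j" if "j < length xs" for j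
    using that bij by (simp add: w_def the_inv_into_f_f bij_betw_def)
  have "(\<Sum>x\<in>set xs. scale (w x) x) = (\<Sum>j<length xs. scale (w (xs ! j)) (xs ! j))"
    by (rule sum.reindex_bij_betw[OF bij, symmetric])
  also have "\<dots> = 0" using assms(3) w by simp
  finally have "w (xs ! j) = 0"
    using independentD[OF assms(2), of "set xs" w "xs ! j"] assms(4) by simp
  then show ?thesis using w assms(4) by simp
qed

lemma linear_rename_vars: "Vector_Spaces.linear pscale pscale (rename_vars \<sigma>)"
  unfolding rename_vars_def by (rule linear_lin_ext) (rule free.vector_space_axioms)

lemma rename_vars_compose: "rename_vars \<tau> (rename_vars \<sigma> p) = rename_vars (\<tau> \<circ> \<sigma>) p"
proof -
  have "rename_vars \<tau> (rename_vars \<sigma> p) =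
      lin_ext pscale (\<lambda>m. rename_vars \<tau> (pure (map (apfst \<sigma>) m))) p"
    unfolding rename_vars_def[of \<sigma>] by (rule lin_ext_compose[OF linear_rename_vars])
  also have "\<dots> = rename_vars (\<tau> \<circ> \<sigma>) p"
    by (simp add: rename_vars_def free.vector_space_axioms apfst_compose o_def)
  finally show ?thesis .
qed

lemma multilinear_hpoly_subspace:
  "free.subspace {p :: ('f::field, 'h) hpoly. multilinear_hpoly K V p}"
proof -
  have "{p :: ('f, 'h) hpoly. multilinear_hpoly K V p} = {p. Poly_Mapping.keys p \<subseteq>
      {m. m \<noteq> [] \<and> distinct (map fst m) \<and> fst ` set m = V \<and> snd ` set m \<subseteq> K}}"
    by (auto simp: multilinear_hpoly_def)
  then show ?thesis by (simp only: subspace_keys)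
qed

lemma multilinear_hpoly_pure:
  "m \<noteq> [] \<Longrightarrow> distinct (map fst m) \<Longrightarrow> fst ` set m = V \<Longrightarrow> snd ` set m \<subseteq> K \<Longrightarrow>
    multilinear_hpoly K V (pure m)"
  by (simp add: multilinear_hpoly_def)

lemma multilinear_hpoly_rename:
  assumes p: "multilinear_hpoly K V p" and "inj \<sigma>" "\<sigma> ` V = V"
  shows "multilinear_hpoly K V (rename_vars \<sigma> p)"
proof -
  have "multilinear_hpoly K V (pure (map (apfst \<sigma>) m))" if "m \<in> Poly_Mapping.keys p" for m
  proof -
    have m: "m \<noteq> []" "distinct (map fst m)" "fst ` set m = V" "snd ` set m \<subseteq> K"
      using p that by (auto simp: multilinear_hpoly_def)
    have "map fst (map (apfst \<sigma>) m) = map \<sigma> (map fst m)" by simp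
    moreover have "distinct (map \<sigma> (map fst m))"
      unfolding distinct_map[of \<sigma>] using m(2) \<open>inj \<sigma>\<close> by (meson inj_on_subset subset_UNIV)
    moreover have "fst ` set (map (apfst \<sigma>) m) = \<sigma> ` fst ` set m" by (simp add: image_image)
    moreover have "snd ` set (map (apfst \<sigma>) m) = snd ` set m" by (simp add: image_image)
    ultimately show ?thesis using m assms(3) by (intro multilinear_hpoly_pure) auto
  qed
  then have "rename_vars \<sigma> p \<in> {p. multilinear_hpoly K V p}"
    unfolding rename_vars_def by (intro free.lin_ext_in_subspace multilinear_hpoly_subspace) simp
  then show ?thesis by simp
qed

text \<open>The map \<open>q\<close> labels the variables. With the block as label this is the
  product of the symmetric groups of the blocks; with block and layer it is the subgroup that also
  preserves layers.\<close>

definition block_permutations :: "('v \<Rightarrow> 'b) \<Rightarrow> 'v set \<Rightarrow> ('v \<Rightarrow> 'v) set" where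
  "block_permutations q U = {\<sigma>. \<sigma> permutes U \<and> (\<forall>x. q (\<sigma> x) = q x)}"

lemma finite_block_permutations: "finite U \<Longrightarrow> finite (block_permutations q U)"
  unfolding block_permutations_def by (rule finite_subset[OF _ finite_permutations[of U]]) auto

lemma block_permutations_compose:
  "\<sigma> \<in> block_permutations q U \<Longrightarrow> \<tau> \<in> block_permutations q U \<Longrightarrow> \<sigma> \<circ> \<tau> \<in> block_permutations q U"
  by (auto simp: block_permutations_def permutes_compose)

lemma block_permutations_inv:
  assumes "\<sigma> \<in> block_permutations q U"
  shows "inv \<sigma> \<in> block_permutations q U"
proof -
  have \<sigma>: "\<sigma> permutes U" "\<And>x. q (\<sigma> x) = q x" using assms by (auto simp: block_permutations_def)
  have "q (inv \<sigma> x) = q x" for x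
    using \<sigma>(2)[of "inv \<sigma> x"] permutes_inverses(1)[OF \<sigma>(1)] by simp
  then show ?thesis using \<sigma> by (simp add: block_permutations_def permutes_inv)
qed

lemma sign_compose_block_permutations:
  assumes "finite U" "\<sigma> \<in> block_permutations q U" "\<tau> \<in> block_permutations q U"
  shows "sign (\<sigma> \<circ> \<tau>) = sign \<sigma> * sign \<tau>"
  using assms by (intro sign_compose) (auto simp: block_permutations_def permutation_permutes)

lemma transpose_block_permutation:
  "a \<in> U \<Longrightarrow> b \<in> U \<Longrightarrow> q a = q b \<Longrightarrow> transpose a b \<in> block_permutations q U"
  by (auto simp: block_permutations_def permutes_swap_id transpose_def)

definition alternate :: "(var \<Rightarrow> 'b) \<Rightarrow> var set \<Rightarrow> ('f::field, 'h) hpoly \<Rightarrow> ('f, 'h) hpoly" where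
  "alternate q U p = (\<Sum>\<sigma>\<in>block_permutations q U. pscale (of_int (sign \<sigma>)) (rename_vars \<sigma> p))"

text \<open>Left composition with \<open>\<tau>\<close> permutes the summands and changes each sign
  by that of \<open>\<tau>\<close>. The equality already holds between representatives, before
  passing to the tensor quotient.\<close>

lemma rename_alternate:
  fixes p :: "('f::field, 'h) hpoly"
  assumes U: "finite U" and \<tau>: "\<tau> \<in> block_permutations q U"
  shows "rename_vars \<tau> (alternate q U p) = pscale (of_int (sign \<tau>)) (alternate q U p)"
proof -
  let ?G = "block_permutations q U"
  interpret L: Vector_Spaces.linear pscale pscale "rename_vars \<tau>" by (rule linear_rename_vars)
  have sq: "of_int (sign \<tau>) * of_int (sign \<tau>) = (1::'f)"
    by (simp add: sign_def)
  have bij: "bij_betw ((\<circ>) \<tau>) ?G ?G"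
  proof (rule bij_betw_byWitness[where f' = "(\<circ>) (inv \<tau>)"])
    have "\<tau> permutes U" using \<tau> by (simp add: block_permutations_def)
    then show "\<forall>\<sigma>\<in>?G. inv \<tau> \<circ> (\<tau> \<circ> \<sigma>) = \<sigma>" "\<forall>\<sigma>\<in>?G. \<tau> \<circ> (inv \<tau> \<circ> \<sigma>) = \<sigma>"
      by (simp_all add: permutes_inv_o comp_assoc[symmetric])
  qed (use \<tau> block_permutations_inv[OF \<tau>] in \<open>auto intro: block_permutations_compose\<close>)
  have "rename_vars \<tau> (alternate q U p) =
      (\<Sum>\<sigma>\<in>?G. pscale (of_int (sign \<sigma>)) (rename_vars (\<tau> \<circ> \<sigma>) p))"
    by (simp add: alternate_def L.sum L.scale rename_vars_compose)
  also have "\<dots> = (\<Sum>\<sigma>\<in>?G. pscale (of_int (sign \<tau>)) (pscale (of_int (sign (\<tau> \<circ> \<sigma>))) (rename_vars (\<tau> \<circ> \<sigma>) p)))"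
    by (intro sum.cong refl)
      (simp add: sign_compose_block_permutations[OF U \<tau>] mult.assoc[symmetric] sq)
  also have "\<dots> = (\<Sum>\<sigma>\<in>?G. pscale (of_int (sign \<tau>)) (pscale (of_int (sign \<sigma>)) (rename_vars \<sigma> p)))"
    by (rule sum.reindex_bij_betw[OF bij])
  also have "\<dots> = pscale (of_int (sign \<tau>)) (alternate q U p)"
    by (simp only: alternate_def free.scale_sum_right)
  finally show ?thesis .
qed

lemma multilinear_alternate:
  assumes p: "multilinear_hpoly K V p" and "U \<subseteq> V"
  shows "multilinear_hpoly K V (alternate q U p)"
proof -
  have "rename_vars \<sigma> p \<in> {p. multilinear_hpoly K V p}" if "\<sigma> \<in> block_permutations q U" for \<sigma>
  proof -
    have "\<sigma> permutes V" using that assms(2) by (auto simp: block_permutations_def intro: permutes_subset)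
    then show ?thesis
      using p by (simp add: multilinear_hpoly_rename permutes_inj permutes_image)
  qed
  then have "alternate q U p \<in> {p. multilinear_hpoly K V p}"
    unfolding alternate_def
    by (intro free.subspace_sum free.subspace_scale multilinear_hpoly_subspace)
  then show ?thesis by simp
qed

lemma hpoly_eq_refl: "hpoly_eq s K p p"
  by (simp add: hpoly_eq_def slot_relations_def free.span_zero)

text \<open>The value at \<open>Z j\<close> is a dummy: the permutations used later move only
  variables \<open>X i j\<close>.\<close>

fun block :: "var \<Rightarrow> nat" where
  "block (X i j) = i"
| "block (Z j) = 0"

lemma alternating_in_alternate:
  assumes "finite U" "{X i j | j. j < n} \<subseteq> U"
  shows "alternating_in s K {X i j | j. j < n} (alternate block U p)"
  unfolding alternating_in_def
proof (intro allI impI)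
  fix \<pi> assume \<pi>: "\<pi> permutes {X i j | j. j < n}"
  have "block (\<pi> x) = block x" for x
  proof (cases "x \<in> {X i j | j. j < n}")
    case True
    then have "\<pi> x \<in> {X i j | j. j < n}" using permutes_in_image[OF \<pi>] by blast
    with True show ?thesis by auto
  next
    case False
    then show ?thesis using \<pi> by (simp add: permutes_def)
  qed
  then have "\<pi> \<in> block_permutations block U"
    using permutes_subset[OF \<pi> assms(2)] by (simp add: block_permutations_def)
  then show "hpoly_eq s K (rename_vars \<pi> (alternate block U p)) (pscale (of_int (sign \<pi>)) (alternate block U p))"
    by (simp add: rename_alternate[OF assms(1)] hpoly_eq_refl)
qed

lemma finite_X_vars: "finite {X i j | i j. i < m \<and> j < n}"
  by (rule finite_subset[of _ "case_prod X ` ({..<m} \<times> {..<n})"]) auto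

text \<open>By multilinearity only tuples of basis vectors matter; such a tuple has a repetition within a
  block or permutes the basis in every block.\<close>

lemma (in module_algebra) alternating_vanishes_if_on_basis:
  fixes f :: "('f, 'h) hpoly"
  assumes char: "(2::'f) \<noteq> 0" and f: "multilinear_hpoly K V f" and basis: "is_basis as"
    and U: "U = {X i j | i j. i < m \<and> j < length as}" "U \<subseteq> V"
    and alt: "\<And>\<rho> \<tau>. \<tau> \<in> block_permutations block U \<Longrightarrow>
      eval_hpoly (\<rho> \<circ> \<tau>) f = scale (of_int (sign \<tau>)) (eval_hpoly \<rho> f)"
    and \<rho>0: "\<And>i j. X i j \<in> U \<Longrightarrow> \<rho>0 (X i j) = as ! j" and zero: "eval_hpoly \<rho>0 f = 0"
    and \<rho>: "\<And>x. x \<in> V \<Longrightarrow> \<rho> x \<in> A" "\<And>x. x \<in> V - U \<Longrightarrow> \<rho> x = \<rho>0 x"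
  shows "eval_hpoly \<rho> f = 0"
proof -
  have finU: "finite U" unfolding U by (rule finite_X_vars)
  have basis_case: "eval_hpoly \<rho> f = 0"
    if \<rho>: "\<And>x. x \<in> U \<Longrightarrow> \<rho> x \<in> set as" "\<And>x. x \<in> V - U \<Longrightarrow> \<rho> x = \<rho>0 x" for \<rho>
  proof (cases "\<exists>a\<in>U. \<exists>b\<in>U. a \<noteq> b \<and> block a = block b \<and> \<rho> a = \<rho> b")
    case True
    then obtain a b where ab: "a \<in> U" "b \<in> U" "a \<noteq> b" "block a = block b" "\<rho> a = \<rho> b" by blast
    \<comment> \<open>Exchanging two variables with equal values leaves the substitution unchanged
      but reverses the sign of the value, so twice the value is 0.\<close>
    have "\<rho> \<circ> transpose a b = \<rho>" using ab by (auto simp: fun_eq_iff transpose_def)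
    then have "eval_hpoly \<rho> f = - eval_hpoly \<rho> f"
      using alt[OF transpose_block_permutation[of a U b block], of \<rho>] ab by (simp add: sign_transpose)
    then have "scale 2 (eval_hpoly \<rho> f) = 0"
      using scale_left_distrib[of 1 1 "eval_hpoly \<rho> f"] by (simp add: eq_neg_iff_add_eq_0)
    with char show ?thesis by simp
  next
    case False
    define idx where "idx y = (SOME j. j < length as \<and> as ! j = y)" for y
    have idx: "idx y < length as" "as ! idx y = y" if "y \<in> set as" for y
      using someI_ex[of "\<lambda>j. j < length as \<and> as ! j = y"] that by (auto simp: idx_def in_set_conv_nth)
    \<comment> \<open>Each variable is sent to the variable of its block that carries the same basis
      vector under \<open>\<rho>0\<close>. Without repetitions this is injective on the finite set
      \<open>U\<close>, hence a permutation, and \<open>\<rho>\<close> agrees with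
      \<open>\<rho>0 \<circ> \<sigma>\<close> on \<open>V\<close>.\<close>
    define \<sigma> where "\<sigma> x = (if x \<in> U then X (block x) (idx (\<rho> x)) else x)" for x
    have \<sigma>U: "\<sigma> x \<in> U" if "x \<in> U" for x
      using that \<rho>(1)[OF that] idx by (auto simp: \<sigma>_def U)
    have "inj_on \<sigma> U"
    proof (rule inj_onI)
      fix x y assume xy: "x \<in> U" "y \<in> U" "\<sigma> x = \<sigma> y"
      then have "block x = block y" "idx (\<rho> x) = idx (\<rho> y)"
        by (simp_all add: \<sigma>_def)
      moreover from this(2) have "\<rho> x = \<rho> y"
        using idx(2)[OF \<rho>(1)[OF xy(1)]] idx(2)[OF \<rho>(1)[OF xy(2)]] by metis
      moreover note False
      ultimately show "x = y" using xy(1,2) by blast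
    qed
    then have "bij_betw \<sigma> U U"
      using endo_inj_surj[OF finU] \<sigma>U by (auto simp: bij_betw_def)
    then have "\<sigma> permutes U" by (rule bij_imp_permutes) (simp add: \<sigma>_def)
    then have "\<sigma> \<in> block_permutations block U" by (simp add: block_permutations_def \<sigma>_def)
    from alt[OF this, of \<rho>0] have "eval_hpoly (\<rho>0 \<circ> \<sigma>) f = 0" by (simp add: zero)
    moreover have "eval_hpoly (\<rho>0 \<circ> \<sigma>) f = eval_hpoly \<rho> f"
    proof (rule eval_hpoly_cong[OF f])
      fix x assume x: "x \<in> V"
      show "(\<rho>0 \<circ> \<sigma>) x = \<rho> x"
      proof (cases "x \<in> U")
        case True
        have "(\<rho>0 \<circ> \<sigma>) x = as ! idx (\<rho> x)"
          using \<rho>0[of "block x" "idx (\<rho> x)"] \<sigma>U[OF True] True by (simp add: \<sigma>_def)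
        also have "\<dots> = \<rho> x" by (rule idx(2)[OF \<rho>(1)[OF True]])
        finally show ?thesis .
      qed (use x \<rho>(2) in \<open>simp add: \<sigma>_def\<close>)
    qed
    ultimately show ?thesis by simp
  qed
  \<comment> \<open>Basis vectors are replaced by arbitrary elements one variable at a time;
    \<open>S\<close> collects the variables whose values are no longer required to be basis
    vectors.\<close>
  have "eval_hpoly \<rho> f = 0"
    if "finite S" "S \<subseteq> U" "\<And>x. x \<in> U - S \<Longrightarrow> \<rho> x \<in> set as" "\<And>x. x \<in> V \<Longrightarrow> \<rho> x \<in> A"
      "\<And>x. x \<in> V - U \<Longrightarrow> \<rho> x = \<rho>0 x" for S \<rho>
    using that
  proof (induction S arbitrary: \<rho> rule: finite_induct)
    case empty
    then show ?case by (intro basis_case) auto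
  next
    case (insert x S)
    have x: "x \<in> V" using insert.prems(1) U(2) by auto
    have as: "set as \<subseteq> A" "span (set as) = A"
      using basis span_superset by (auto simp: is_basis_def)
    have "subspace {y \<in> A. eval_hpoly (\<rho>(x := y)) f = 0}"
      by (rule eval_hpoly_subspace[OF f x]) (rule insert.prems)
    moreover have "set as \<subseteq> {y \<in> A. eval_hpoly (\<rho>(x := y)) f = 0}"
    proof safe
      fix y assume y: "y \<in> set as"
      then show "y \<in> A" using as by auto
      show "eval_hpoly (\<rho>(x := y)) f = 0"
        using insert.prems insert.hyps y \<open>y \<in> A\<close> by (intro insert.IH) auto
    qed
    ultimately have "span (set as) \<subseteq> {y \<in> A. eval_hpoly (\<rho>(x := y)) f = 0}"
      by (intro span_minimal)
    then have "\<rho> x \<in> {y \<in> A. eval_hpoly (\<rho>(x := y)) f = 0}"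
      using as insert.prems(3)[OF x] by blast
    then show ?case by simp
  qed
  from this[OF finU] show ?thesis using \<rho> by simp
qed

section \<open>The layered basis and the lifted polynomial\<close>

fun layer :: "nat \<Rightarrow> var \<Rightarrow> nat" where
  "layer d (X i r) = r div d"
| "layer d (Z j) = 0"

locale simple_chain_quotient =
  simple_chain hscale comult counit antipode scale A mul act Ht v g1 g2 \<phi> I T +
  Q: module_algebra hscale comult counit antipode s "p ` A" mul' Ht act'
  for hscale :: "'f::field_char_0 \<Rightarrow> 'h::ring_1 \<Rightarrow> 'h"
    and comult counit antipode
    and scale :: "'f \<Rightarrow> 'a::ab_group_add \<Rightarrow> 'a"
    and A mul act Ht v g1 g2 \<phi> I T
    and s :: "'f \<Rightarrow> 'b::ab_group_add \<Rightarrow> 'b" and p mul' act' +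
  fixes cs :: "'a list"
  assumes p_linear: "Vector_Spaces.linear scale s p"
    and p_kernel: "a \<in> A \<Longrightarrow> p a = 0 \<longleftrightarrow> a \<in> W T"
    and p_mul: "\<lbrakk>a \<in> A; b \<in> A\<rbrakk> \<Longrightarrow> mul' (p a) (p b) = p (mul a b)"
    and p_act: "\<lbrakk>h \<in> Ht; a \<in> A\<rbrakk> \<Longrightarrow> act' h (p a) = p (act h a)"
    and cs: "distinct cs" "independent (set cs)" "span (set cs) = I"
begin

sublocale p: Vector_Spaces.linear scale s p by (rule p_linear)

lemma p_W_zero: "x \<in> W T \<Longrightarrow> p x = 0"
  using p_kernel[of x] W_simps(3)[of x T] by simp

section \<open>The top factor is an admissible algebra for the hypothesis\<close>

lemma quotient_finite_dimensional: Q.finite_dimensional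
proof -
  obtain B where "finite B" "B \<subseteq> A" "span B = A"
    using finite_dim by (auto simp: finite_dimensional_def)
  then have "finite (p ` B)" "p ` B \<subseteq> p ` A" "Q.span (p ` B) = p ` A"
    by (auto simp: p.span_image)
  then show ?thesis unfolding Q.finite_dimensional_def by blast
qed

text \<open>By the coproduct rule \<open>H\<close> maps a product to a sum of products, so the span
  is a nonzero \<open>H\<close>-invariant ideal. This is what keeps the products in
  \<open>A / W T\<close> from vanishing.\<close>

lemma span_products: "span {mul a b | a b. a \<in> A \<and> b \<in> A} = A"
proof -
  let ?P = "{mul a b | a b. a \<in> A \<and> b \<in> A}"
  have sub: "span ?P \<subseteq> A" by (rule span_minimal) (auto simp: subspace_carrier)
  have act: "act h x \<in> span ?P" if "x \<in> span ?P" for h x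
  proof -
    let ?S = "{x \<in> A. act h x \<in> span ?P}"
    have "subspace ?S"
      by (auto simp: subspace_def act_0 act_add_right act_scale span_zero span_add span_scale)
    moreover have "?P \<subseteq> ?S"
    proof safe
      fix a b assume ab: "a \<in> A" "b \<in> A"
      have "sweedler UNIV h (comult h)"
        by (simp add: sweedler_def tensor2_eq_def slot_relations_def free.span_zero)
      from act_mul[OF _ this ab]
      have "act h (mul a b) = lin_ext scale (\<lambda>(h1, h2). mul (act h1 a) (act h2 b)) (comult h)" by simp
      also have "\<dots> \<in> span ?P"
      proof (rule lin_ext_in_subspace[OF subspace_span])
        fix m :: "'h \<times> 'h"
        have "act (fst m) a \<in> A" "act (snd m) b \<in> A" using ab by simp_all
        then have "mul (act (fst m) a) (act (snd m) b) \<in> ?P" by blast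
        then show "(case m of (h1, h2) \<Rightarrow> mul (act h1 a) (act h2 b)) \<in> span ?P"
          by (simp only: case_prod_unfold span_base)
      qed
      finally show "act h (mul a b) \<in> span ?P" .
      show "mul a b \<in> A" using ab by simp
    qed
    ultimately have "span ?P \<subseteq> ?S" by (intro span_minimal)
    with that show ?thesis by auto
  qed
  have "mul a x \<in> span ?P" "mul x a \<in> span ?P" if "a \<in> A" "x \<in> span ?P" for a x
    using that sub by (auto intro!: span_base)
  then have "invariant_ideal (span ?P)"
    using sub act by (auto simp: invariant_ideal_def)
  then show ?thesis using simple by (auto simp: simple_def)
qed

lemma quotient_simple: Q.simple
  unfolding Q.simple_def
proof (intro conjI allI impI)
  show "Q.span {mul' a b | a b. a \<in> p ` A \<and> b \<in> p ` A} \<noteq> {0}"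
  proof
    assume eq: "Q.span {mul' a b | a b. a \<in> p ` A \<and> b \<in> p ` A} = {0}"
    have "mul a b \<in> W T" if ab: "a \<in> A" "b \<in> A" for a b
    proof -
      have "mul' (p a) (p b) \<in> Q.span {mul' a b | a b. a \<in> p ` A \<and> b \<in> p ` A}"
        using ab by (intro Q.span_base) blast
      then show ?thesis using eq ab p_kernel[of "mul a b"] by (simp add: p_mul)
    qed
    then have "span {mul a b | a b. a \<in> A \<and> b \<in> A} \<subseteq> W T"
      by (intro span_minimal W_simps) auto
    then show False using chain_proper W_simps(2)[of T] by (simp add: span_products)
  qed
next
  fix L assume L: "Q.invariant_ideal L"
  have sub: "Q.subspace L" "L \<subseteq> p ` A"
    and mult: "\<And>a x. a \<in> p ` A \<Longrightarrow> x \<in> L \<Longrightarrow> mul' a x \<in> L \<and> mul' x a \<in> L"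
    and actL: "\<And>h x. h \<in> Ht \<Longrightarrow> x \<in> L \<Longrightarrow> act' h x \<in> L"
    using L by (auto simp: Q.invariant_ideal_def)
  \<comment> \<open>The preimage of \<open>L\<close> lies between \<open>W T\<close> and
    \<open>W (T + 1) = A\<close>, so irreducibility of the top factor of the chain decides.\<close>
  let ?M = "{a \<in> A. p a \<in> L}"
  have "R.invariant_ideal ?M"
    using sub mult actL
    by (intro R_invariant_idealI)
      (auto simp: p.add p.scale Q.subspace_0 Q.subspace_add Q.subspace_scale simp flip: p_mul p_act)
  moreover have "W T \<subseteq> ?M"
    using p_W_zero W_simps(3) Q.subspace_0[OF sub(1)] by auto
  ultimately have "?M = W T \<or> ?M = A"
    using W_irreducible[of ?M T] chain_top by auto
  moreover have L_eq: "L = p ` ?M" using sub by auto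
  moreover have "p ` W T = {0}"
    using p_W_zero W_simps(4)[of T] by force
  ultimately show "L = {0} \<or> L = p ` A" by metis
qed

lemma unital_lift:
  assumes Q.unital
  shows unital
proof -
  obtain e where e: "e \<in> A" "\<And>a. a \<in> A \<Longrightarrow> mul' (p e) (p a) = p a \<and> mul' (p a) (p e) = p a"
    using assms by (auto simp: Q.unital_def)
  have "mul e a - a \<in> W T" "mul a e - a \<in> W T" if "a \<in> A" for a
    using e that by (auto simp: p_mul p.diff simp flip: p_kernel)
  then show ?thesis
    using e by (intro unital_if_unit_mod[of e]) (auto simp: unit_mod_def)
qed

section \<open>The basis adapted to the chain\<close>

abbreviation d :: nat where "d \<equiv> length cs"

lemma d_pos: "0 < d"
  using cs(3) I_nonzero by (cases cs) auto

lemma cs_in_I: "j < d \<Longrightarrow> cs ! j \<in> I"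
  using cs(3) span_base by fastforce

text \<open>Enumerates the vectors \<open>v^i c_j\<close> layer by layer: position
  \<open>r = i d + j\<close> with \<open>j < d\<close>, so \<open>r div d\<close> is the layer and
  applying \<open>v\<close> adds \<open>d\<close> to the position.\<close>

definition layered :: "nat \<Rightarrow> 'a" where
  "layered r = act (v ^ (r div d)) (cs ! (r mod d))"

lemma layered_A [simp]: "layered r \<in> A"
  using cs_in_I[of "r mod d"] I_simps(3) d_pos by (simp add: layered_def)

lemma layered_low: "r < d \<Longrightarrow> layered r = cs ! r"
  using cs_in_I[of r] I_simps(3) by (simp add: layered_def act_one)

lemma layered_add: "act v (layered r) = layered (d + r)"
  using cs_in_I[of "r mod d"] I_simps(3) d_pos by (simp add: layered_def act_mult)

lemma layered_shift: "act (v ^ n) (layered r) = layered (r + n * d)"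
proof (induction n)
  case 0
  show ?case by (simp add: act_one)
next
  case (Suc n)
  then show ?case by (simp add: act_mult layered_add algebra_simps)
qed

lemma layered_in_W: "r < k * d \<Longrightarrow> layered r \<in> W k"
proof (induction k arbitrary: r)
  case (Suc k)
  show ?case
  proof (cases "r < d")
    case True
    then show ?thesis using cs_in_I I_subset_W by (simp add: layered_low)
  next
    case False
    then have "layered r = act v (layered (r - d))" "r - d < k * d"
      using Suc.prems by (auto simp: layered_add)
    then show ?thesis using Suc.IH act_v_W by auto
  qed
qed simp

lemma layered_sum_W: "(\<Sum>r<k * d. scale (u r) (layered r)) \<in> W k"
  using W_simps(1) layered_in_W by (intro subspace_sum subspace_scale) auto

lemma layered_sum_Suc:
  "(\<Sum>r<Suc k * d. scale (u r) (layered r)) =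
    (\<Sum>j<d. scale (u j) (cs ! j)) + act v (\<Sum>r<k * d. scale (u (d + r)) (layered r))"
  by (simp add: sum_lessThan_add linear_on_sum layered_add layered_low)

text \<open>Splitting off the part in \<open>I\<close> leaves \<open>v ?y\<close>, where
  \<open>?y\<close> has the coefficients shifted by \<open>d\<close>. Injectivity of
  \<open>v\<close> between factors puts \<open>?y\<close> one level lower, so the claim descends
  layer by layer until it becomes the independence of \<open>cs\<close>.\<close>

lemma layered_top_coeffs:
  "\<lbrakk>k \<le> T; (\<Sum>r<Suc k * d. scale (u r) (layered r)) \<in> W k; k * d \<le> r; r < Suc k * d\<rbrakk> \<Longrightarrow> u r = 0"
proof (induction k arbitrary: u r)
  case 0
  then show ?case
    using independent_list_coeffs[OF cs(1,2), of u r] by (simp add: layered_low)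
next
  case (Suc k)
  let ?x = "\<Sum>j<d. scale (u j) (cs ! j)"
  let ?y = "\<Sum>r<Suc k * d. scale (u (d + r)) (layered r)"
  have "?x \<in> I"
    using I_simps(1) cs_in_I by (intro subspace_sum subspace_scale) auto
  then have "(?x + act v ?y) - ?x \<in> W (Suc k)"
    using Suc.prems(2) I_subset_W by (intro W_simps(6)) (simp_all only: layered_sum_Suc)
  then have vy: "act v ?y \<in> W (Suc k)" by (simp only: add_diff_cancel_left')
  have "k < T" using Suc.prems(1) by simp
  from act_v_kernel[OF this layered_sum_W vy] have y: "?y \<in> W k" .
  have "u (d + (r - d)) = 0"
    by (rule Suc.IH[of "\<lambda>r. u (d + r)" "r - d", OF _ y]) (use Suc.prems in auto)
  then show ?case using Suc.prems by simp
qed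

lemma layered_coeffs:
  "\<lbrakk>k \<le> Suc T; (\<Sum>r<k * d. scale (u r) (layered r)) = 0\<rbrakk> \<Longrightarrow> \<forall>r<k * d. u r = 0"
proof (induction k)
  case (Suc k)
  have top: "u r = 0" if "k * d \<le> r" "r < Suc k * d" for r
    using layered_top_coeffs[of k u r] Suc.prems W_simps(4) that by simp
  have "(\<Sum>r<Suc k * d. scale (u r) (layered r)) = (\<Sum>r<k * d. scale (u r) (layered r))"
    by (rule sum.mono_neutral_right) (use top in auto)
  then have "\<forall>r<k * d. u r = 0" using Suc by simp
  with top show ?case by (metis not_le_imp_less)
qed simp

text \<open>The Horner recursion again: \<open>I\<close> is spanned by layer 0, and \<open>v\<close>
  moves each listed vector one layer up.\<close>

lemma W_span: "W k \<subseteq> span (layered ` {..<k * d})"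
proof (induction k)
  case (Suc k)
  have low: "x \<in> span (layered ` {..<Suc k * d})" if "x \<in> I" for x
  proof -
    have "set cs \<subseteq> layered ` {..<Suc k * d}"
    proof
      fix c assume "c \<in> set cs"
      then obtain j where "j < d" "c = layered j" by (auto simp: in_set_conv_nth layered_low)
      then show "c \<in> layered ` {..<Suc k * d}" by auto
    qed
    then show ?thesis using span_mono cs(3) that by blast
  qed
  have high: "act v y \<in> span (layered ` {..<Suc k * d})" if y: "y \<in> W k" for y
  proof -
    obtain u where u: "y = (\<Sum>r<k * d. scale (u r) (layered r))"
      using Suc.IH y span_family_explicit[of y layered "k * d"] by blast
    have "act v y = (\<Sum>r<k * d. scale (u r) (layered (d + r)))"
      by (simp add: u linear_on_sum layered_add)
    also have "\<dots> \<in> span (layered ` {..<Suc k * d})"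
      by (intro span_sum span_scale span_base) auto
    finally show ?thesis .
  qed
  show ?case
    unfolding W_Suc extend_ideal_def using low high by (auto intro: span_add)
qed simp

lemma layered_basis: "is_basis (map layered [0..<Suc T * d])"
proof -
  have "distinct (map layered [0..<Suc T * d]) \<and> independent (set (map layered [0..<Suc T * d]))"
    by (rule independent_family) (use layered_coeffs[of "Suc T"] in auto)
  moreover have "span (set (map layered [0..<Suc T * d])) = A"
  proof
    show "span (set (map layered [0..<Suc T * d])) \<subseteq> A"
      by (rule span_minimal) (auto simp: subspace_carrier)
    show "A \<subseteq> span (set (map layered [0..<Suc T * d]))"
      using W_span[of "Suc T"] chain_top by (simp add: atLeast0LessThan)
  qed
  ultimately show ?thesis by (simp add: is_basis_def)
qed

lemma length_basis:
  assumes "is_basis as"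
  shows "length as = Suc T * d"
proof -
  have "card (set bs) = dim A" if "is_basis bs" for bs
    using that span_superset[of "set bs"] by (intro basis_card_eq_dim) (auto simp: is_basis_def)
  then have "card (set as) = card (set (map layered [0..<Suc T * d]))"
    using assms layered_basis by metis
  then show ?thesis
    using assms layered_basis by (simp only: is_basis_def distinct_card length_map length_upt diff_zero)
qed

definition top_basis :: "'b list" where
  "top_basis = map (\<lambda>j. p (layered (T * d + j))) [0..<d]"

lemma top_basis: "Q.is_basis top_basis"
proof -
  have "distinct top_basis \<and> Q.independent (set top_basis)"
    unfolding top_basis_def
  proof (rule Q.independent_family)
    fix u assume "(\<Sum>j<d. s (u j) (p (layered (T * d + j)))) = 0"
    then have "p (\<Sum>j<d. scale (u j) (layered (T * d + j))) = 0"
      by (simp add: p.sum p.scale)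
    then have in_W: "(\<Sum>j<d. scale (u j) (layered (T * d + j))) \<in> W T"
      using subspace_carrier by (subst (asm) p_kernel) (auto intro: subspace_sum)
    \<comment> \<open>The coefficients are padded with zeros on the lower layers, so that a relation
      modulo \<open>W T\<close> becomes a statement about the top layer.\<close>
    let ?w = "\<lambda>r. if r < T * d then 0 else u (r - T * d)"
    have "(\<Sum>r<Suc T * d. scale (?w r) (layered r)) = (\<Sum>j<d. scale (u j) (layered (T * d + j)))"
      using sum_lessThan_add[of "\<lambda>r. scale (?w r) (layered r)" "T * d" d]
      by (simp add: add.commute)
    then have "?w (T * d + j) = 0" if "j < d" for j
      using layered_top_coeffs[of T ?w "T * d + j"] in_W that by simp
    then show "\<forall>j<d. u j = 0" by simp
  qed
  moreover have "Q.span (set top_basis) = p ` A"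
  proof -
    have "set top_basis \<subseteq> p ` (layered ` {..<Suc T * d})"
      by (auto simp: top_basis_def)
    moreover have "p ` (layered ` {..<Suc T * d}) \<subseteq> Q.span (set top_basis)"
    proof safe
      fix r assume r: "r < Suc T * d"
      show "p (layered r) \<in> Q.span (set top_basis)"
      proof (cases "r < T * d")
        case True
        then show ?thesis using layered_in_W p_W_zero by (simp add: Q.span_zero)
      next
        case False
        then have "p (layered r) = p (layered (T * d + (r - T * d)))" "r - T * d < d"
          using r by auto
        then show ?thesis unfolding top_basis_def by (intro Q.span_base) auto
      qed
    qed
    ultimately have "Q.span (set top_basis) = Q.span (p ` (layered ` {..<Suc T * d}))"
      by (metis Q.span_mono Q.span_minimal Q.subspace_span subset_antisym)
    also have "\<dots> = p ` A"
      using layered_basis by (simp add: p.span_image is_basis_def atLeast0LessThan)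
    finally show ?thesis .
  qed
  ultimately show ?thesis by (simp add: Q.is_basis_def)
qed

text \<open>Block \<open>q\<close> of the polynomial for the quotient becomes the part of the block \<open>q div (T + 1)\<close>
  that belongs to the layer \<open>q mod (T + 1)\<close> of the basis \<open>layered\<close>; the extra exponent
  \<open>v ^ lift_degree x\<close> moves this layer to the top one.\<close>

fun lift_var :: "var \<Rightarrow> var" where
  "lift_var (X q j) = X (q div Suc T) (q mod Suc T * d + j)"
| "lift_var (Z j) = Z j"

fun lift_degree :: "var \<Rightarrow> nat" where
  "lift_degree (X q j) = T - q mod Suc T"
| "lift_degree (Z j) = 0"

text \<open>Mixed-radix inverse of \<open>lift_var\<close>: block \<open>i\<close> and layer
  \<open>r div d\<close> recombine to the quotient block \<open>i (T + 1) + r div d\<close>.\<close>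

fun unlift_var :: "var \<Rightarrow> var" where
  "unlift_var (X i r) = X (i * Suc T + r div d) (r mod d)"
| "unlift_var (Z j) = Z j"

lemma unlift_lift: "j < d \<Longrightarrow> unlift_var (lift_var (X q j)) = X q j"
  using d_pos div_mult_mod_eq[of q "Suc T"] by (simp del: mult_Suc mult_Suc_right)

lemma lift_unlift: "r < Suc T * d \<Longrightarrow> lift_var (unlift_var (X i r)) = X i r"
  by (simp add: less_mult_imp_div_less del: mult_Suc mult_Suc_right)

text \<open>The power of \<open>v\<close> stands to the right of \<open>h\<close>, so it acts first.
  What remains is \<open>h\<close> from \<open>Ht\<close>, whose action commutes with the projection
  \<open>p\<close>.\<close>

definition lift_monomial :: "(var \<times> 'h) list \<Rightarrow> (var \<times> 'h) list" where
  "lift_monomial m = map (\<lambda>(x, h). (lift_var x, h * v ^ lift_degree x)) m"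

definition lift_hpoly :: "('f, 'h) hpoly \<Rightarrow> ('f, 'h) hpoly" where
  "lift_hpoly f = lin_ext pscale (\<lambda>m. pure (lift_monomial m)) f"

lemma multilinear_lift:
  assumes f: "multilinear_hpoly Ht V f" and inj: "inj_on lift_var V"
  shows "multilinear_hpoly UNIV (lift_var ` V) (lift_hpoly f)"
proof -
  have "multilinear_hpoly UNIV (lift_var ` V) (pure (lift_monomial m) :: ('f, 'h) hpoly)"
    if "m \<in> Poly_Mapping.keys f" for m
  proof -
    have m: "m \<noteq> []" "distinct (map fst m)" "fst ` set m = V"
      using f that by (auto simp: multilinear_hpoly_def)
    have fst: "map fst (lift_monomial m) = map lift_var (map fst m)"
      by (simp add: lift_monomial_def case_prod_unfold)
    have "distinct (map lift_var (map fst m))"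
      unfolding distinct_map[of lift_var] using m inj by simp
    then have dist: "distinct (map fst (lift_monomial m))" by (simp only: fst)
    have img: "fst ` set (lift_monomial m) = lift_var ` V"
      using arg_cong[OF fst, of set] m(3) by (simp add: image_image[symmetric])
    show ?thesis
      by (rule multilinear_hpoly_pure[OF _ dist img]) (use m in \<open>auto simp: lift_monomial_def\<close>)
  qed
  then have "lift_hpoly f \<in> {q. multilinear_hpoly UNIV (lift_var ` V) q}"
    unfolding lift_hpoly_def by (intro free.lin_ext_in_subspace multilinear_hpoly_subspace) simp
  then show ?thesis by simp
qed

text \<open>The powers of \<open>v\<close> need not act on the quotient, so they are absorbed into
  the values substituted for the variables, before \<open>p\<close> is applied.\<close>

lemma eval_lift:
  assumes f: "multilinear_hpoly Ht V f" and \<rho>: "\<And>x. \<rho> x \<in> A"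
  shows "p (eval_hpoly \<rho> (lift_hpoly f)) =
    Q.eval_hpoly (\<lambda>x. p (act (v ^ lift_degree x) (\<rho> (lift_var x)))) f"
proof -
  have "p (eval_hpoly \<rho> (lift_hpoly f)) =
      p (lin_ext scale (\<lambda>m. eval_hpoly \<rho> (pure (lift_monomial m))) f)"
    unfolding lift_hpoly_def by (subst lin_ext_compose[OF eval_hpoly_linear]) (rule refl)
  also have "\<dots> = lin_ext s (\<lambda>m. p (eval_monomial mul act \<rho> (lift_monomial m))) f"
    by (subst lin_ext_compose[OF p_linear]) (simp add: eval_hpoly_def vector_space_axioms)
  also have "\<dots> = Q.eval_hpoly (\<lambda>x. p (act (v ^ lift_degree x) (\<rho> (lift_var x)))) f"
    unfolding Q.eval_hpoly_def
  proof (rule lin_ext_cong)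
    fix m assume "m \<in> Poly_Mapping.keys f"
    then have m: "snd ` set m \<subseteq> Ht" using f by (auto simp: multilinear_hpoly_def)
    have "p (eval_monomial mul act \<rho> (lift_monomial m)) =
        word_prod mul' (map p (map (\<lambda>(x, h). act h (\<rho> x)) (lift_monomial m)))"
      unfolding eval_monomial_word_prod
      by (rule word_prod_hom) (use \<rho> in \<open>auto simp: p_mul\<close>)
    also have "map p (map (\<lambda>(x, h). act h (\<rho> x)) (lift_monomial m)) =
        map (\<lambda>(x, h). act' h (p (act (v ^ lift_degree x) (\<rho> (lift_var x))))) m"
      using m \<rho> by (auto simp: lift_monomial_def act_mult p_act image_subset_iff)
    finally show "p (eval_monomial mul act \<rho> (lift_monomial m)) =
        eval_monomial mul' act' (\<lambda>x. p (act (v ^ lift_degree x) (\<rho> (lift_var x)))) m"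
      by (simp only: eval_monomial_word_prod)
  qed
  finally show ?thesis .
qed

end

section \<open>Nonvanishing of the alternated polynomial\<close>

context simple_chain_quotient
begin

lemma lift_property_star:
  assumes star: "Q.property_star top_basis" and basis: "is_basis as"
  shows "property_star as"
proof -
  let ?t = "Suc T"
  have len: "length as = ?t * d" "length top_basis = d"
    using length_basis[OF basis] by (simp_all add: top_basis_def)
  have Q_unital: Q.unital using star by (simp add: Q.property_star_def)
  from star obtain n0 where n0: "\<And>k. \<exists>(f :: ('f, 'h) hpoly) zs.
      length zs \<le> n0 \<and> set zs \<subseteq> p ` A \<and>
      multilinear_hpoly Ht ({X i j | i j. i < 2 * k \<and> j < d} \<union> {Z j | j. j < length zs}) f \<and>
      (\<forall>i<2 * k. alternating_in hscale Ht {X i j | j. j < d} f) \<and>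
      Q.eval_hpoly (case_var (\<lambda>i j. top_basis ! j) (\<lambda>j. zs ! j)) f \<noteq> 0"
    unfolding Q.property_star_def len by blast
  have "\<exists>(f :: ('f, 'h) hpoly) zs. length zs \<le> n0 \<and> set zs \<subseteq> A \<and>
      multilinear_hpoly UNIV ({X i j | i j. i < 2 * k \<and> j < length as} \<union> {Z j | j. j < length zs}) f \<and>
      (\<forall>i<2 * k. alternating_in hscale UNIV {X i j | j. j < length as} f) \<and>
      eval_hpoly (case_var (\<lambda>i j. as ! j) (\<lambda>j. zs ! j)) f \<noteq> 0" for k
  proof -
    \<comment> \<open>The parameter \<open>k (T + 1)\<close> provides \<open>2 k (T + 1)\<close>
      blocks of \<open>d\<close> variables, as many variables as \<open>2 k\<close> blocks of length
      \<open>(T + 1) d\<close>.\<close>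
    obtain f :: "('f, 'h) hpoly" and zs where zs: "length zs \<le> n0" "set zs \<subseteq> p ` A"
      and f: "multilinear_hpoly Ht ({X i j | i j. i < 2 * (k * ?t) \<and> j < d} \<union> {Z j | j. j < length zs}) f"
      and f_alt: "\<And>i. i < 2 * (k * ?t) \<Longrightarrow> alternating_in hscale Ht {X i j | j. j < d} f"
      and f_nz: "Q.eval_hpoly (case_var (\<lambda>i j. top_basis ! j) (\<lambda>j. zs ! j)) f \<noteq> 0"
      using n0[of "k * ?t"] by blast
    define zs' where "zs' = map (inv_into A p) zs"
    have zs': "zs' ! j \<in> A" "p (zs' ! j) = zs ! j" if "j < length zs" for j
    proof -
      have "zs ! j \<in> p ` A" using zs(2) that by auto
      then show "zs' ! j \<in> A" "p (zs' ! j) = zs ! j"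
        using that by (simp_all add: zs'_def inv_into_into f_inv_into_f)
    qed
    have len_zs': "length zs' = length zs" by (simp add: zs'_def)
    have zs'_A: "set zs' \<subseteq> A" using zs' len_zs' by (auto simp: in_set_conv_nth)
    define U where "U = {X i j | i j. i < 2 * k \<and> j < ?t * d}"
    define U' where "U' = {X i j | i j. i < 2 * (k * ?t) \<and> j < d}"
    define ZV where "ZV = {Z j | j. j < length zs}"
    have finU: "finite U" unfolding U_def by (rule finite_X_vars)
    have lift_U: "lift_var x \<in> U" if xU: "x \<in> U'" for x
    proof -
      obtain q j where x: "x = X q j" "q < 2 * k * ?t" "j < d"
        using xU unfolding U'_def mult.assoc by blast
      have "q mod ?t * d + j < Suc (q mod ?t) * d" using x by simp
      also have "\<dots> \<le> ?t * d" by (intro mult_le_mono1) (simp add: Suc_le_eq)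
      finally have "q mod ?t * d + j < ?t * d" .
      moreover have "q div ?t < 2 * k" using x by (simp only: less_mult_imp_div_less)
      ultimately show ?thesis unfolding U_def x lift_var.simps by blast
    qed
    have unlift_U: "unlift_var x \<in> U'" "lift_var (unlift_var x) = x" if xU: "x \<in> U" for x
    proof -
      obtain i r where x: "x = X i r" "i < 2 * k" "r < ?t * d" using xU by (auto simp: U_def)
      have "r div d < ?t" using x by (simp only: less_mult_imp_div_less)
      then have "i * ?t + r div d < Suc i * ?t" by simp
      also have "\<dots> \<le> 2 * k * ?t" using x by (intro mult_le_mono1) simp
      finally have "i * ?t + r div d < 2 * (k * ?t)" by (simp only: mult.assoc)
      then show "unlift_var x \<in> U'" using d_pos by (auto simp: U'_def x)
      show "lift_var (unlift_var x) = x" unfolding x(1) by (rule lift_unlift[OF x(3)])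
    qed
    have lift_ZV: "lift_var ` ZV = ZV" by (force simp: ZV_def)
    have "lift_var ` U' = U"
    proof
      show "U \<subseteq> lift_var ` U'" using unlift_U by (metis image_eqI subsetI)
    qed (use lift_U in auto)
    then have lift_V: "lift_var ` (U' \<union> ZV) = U \<union> ZV" using lift_ZV by (simp add: image_Un)
    have unlift: "unlift_var (lift_var x) = x" if "x \<in> U' \<union> ZV" for x
      using that unlift_lift unfolding U'_def ZV_def by (auto simp del: lift_var.simps(1) unlift_var.simps(1))
    then have lift_inj: "inj_on lift_var (U' \<union> ZV)" by (rule inj_on_inverseI)
    note f' = f[folded U'_def ZV_def]
    define F where "F = alternate block U (lift_hpoly f)"
    have F: "multilinear_hpoly UNIV (U \<union> ZV) F"
      unfolding F_def using multilinear_lift[OF f' lift_inj] lift_V by (intro multilinear_alternate) auto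
    have F_alt: "eval_hpoly (\<rho> \<circ> \<tau>) F = scale (of_int (sign \<tau>)) (eval_hpoly \<rho> F)"
      if "\<tau> \<in> block_permutations block U" for \<rho> \<tau>
    proof -
      interpret L: Vector_Spaces.linear pscale scale "eval_hpoly \<rho>" by (rule eval_hpoly_linear)
      have "eval_hpoly \<rho> (rename_vars \<tau> F) = eval_hpoly \<rho> (pscale (of_int (sign \<tau>)) F)"
        unfolding F_def rename_alternate[OF finU that] ..
      then show ?thesis by (simp add: eval_hpoly_rename L.scale)
    qed
    \<comment> \<open>The layered basis in every block and lifts of the auxiliary elements. The
      default 0 only serves to keep every value in \<open>A\<close>.\<close>
    define \<rho> where "\<rho> x = (case x of X i r \<Rightarrow> layered r | Z j \<Rightarrow> if j < length zs then zs' ! j else 0)" for x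
    have \<rho>A: "\<rho> x \<in> A" for x by (cases x) (auto simp: \<rho>_def zs')
    \<comment> \<open>The substitution that \<open>f\<close> sees in the quotient when the lifted
      polynomial is renamed by \<open>\<sigma>\<close> and evaluated at
      \<open>\<rho>\<close>.\<close>
    define \<theta> where "\<theta> \<sigma> x = p (act (v ^ lift_degree x) (\<rho> (\<sigma> (lift_var x))))" for \<sigma> x
    have \<theta>B: "\<theta> \<sigma> x \<in> p ` A" for \<sigma> x by (simp add: \<theta>_def \<rho>A)
    define c where "c = Q.eval_hpoly (\<theta> id) f"
    have \<theta>_X: "\<theta> \<sigma> (X q j) = p (layered (r + (T - q mod ?t) * d))"
      if "\<sigma> (lift_var (X q j)) = X i r" for \<sigma> q j i r
      using that by (simp add: \<theta>_def \<rho>_def layered_shift)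
    have c_nz: "c \<noteq> 0"
    proof -
      have "c = Q.eval_hpoly (case_var (\<lambda>i j. top_basis ! j) (\<lambda>j. zs ! j)) f"
        unfolding c_def
      proof (rule Q.eval_hpoly_cong[OF f'])
        fix x assume "x \<in> U' \<union> ZV"
        then consider q j where "x = X q j" "j < d" | j where "x = Z j" "j < length zs"
          by (auto simp: U'_def ZV_def)
        then show "\<theta> id x = (case x of X i j \<Rightarrow> top_basis ! j | Z j \<Rightarrow> zs ! j)"
        proof cases
          case 1
          have "\<theta> id x = p (layered (q mod ?t * d + j + (T - q mod ?t) * d))"
            unfolding 1(1) by (rule \<theta>_X) simp
          also have "q mod ?t * d + j + (T - q mod ?t) * d = (q mod ?t + (T - q mod ?t)) * d + j"
            by (simp add: algebra_simps)
          also have "q mod ?t + (T - q mod ?t) = T"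
            using mod_less_divisor[of ?t q] by simp
          also have "p (layered (T * d + j)) = top_basis ! j" using 1 by (simp add: top_basis_def)
          finally show ?thesis by (simp only: 1 var.case)
        next
          case 2
          then show ?thesis by (simp add: \<theta>_def \<rho>_def act_one zs')
        qed
      qed
      then show ?thesis using f_nz by simp
    qed
    let ?G = "block_permutations block U"
    let ?q = "\<lambda>x. (block x, layer d x)"
    let ?H = "block_permutations ?q U"
    have HG: "?H \<subseteq> ?G" by (auto simp: block_permutations_def)
    \<comment> \<open>A transposition within one block and layer corresponds to a transposition
      inside a single block of \<open>f\<close>. The sign from the alternation of \<open>f\<close>
      cancels the sign of the permutation, so every such term equals the term of the
      identity.\<close>
    have term_H: "s (of_int (sign \<sigma>)) (Q.eval_hpoly (\<theta> \<sigma>) f) = c" if "\<sigma> \<in> ?H" for \<sigma>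
    proof -
      have "\<sigma> permutes U" "\<And>x. ?q (\<sigma> x) = ?q x" using that unfolding block_permutations_def by auto
      with finU show ?thesis
      proof (induction rule: fiber_permutation_induct)
        case id
        then show ?case by (simp only: c_def sign_id of_int_1 Q.scale_one)
      next
        case (swap \<tau> a b)
        define a' b' where "a' = inv \<tau> a" and "b' = inv \<tau> b"
        have \<tau>_inv: "\<tau> (inv \<tau> x) = x" for x using permutes_inverses(1)[OF swap(1)] .
        have a': "a' \<in> U" "b' \<in> U"
          using swap(3,4) permutes_in_image[OF permutes_inv[OF swap(1)]] by (simp_all add: a'_def b'_def)
        have ne: "a' \<noteq> b'" using swap(5) \<tau>_inv unfolding a'_def b'_def by metis
        have q: "?q a' = ?q b'"
          using swap(6) swap(2)[of a'] swap(2)[of b'] by (simp add: a'_def b'_def \<tau>_inv)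
        \<comment> \<open>The transposition is moved to the right of \<open>\<tau>\<close>, where it
          acts directly on lifted variables and can be pulled back to the variables of
          \<open>f\<close>.\<close>
        have comp: "transpose a b \<circ> \<tau> = \<tau> \<circ> transpose a' b'"
          unfolding a'_def b'_def by (rule transpose_comp_eq) (rule permutes_bij[OF swap(1)])
        let ?\<alpha> = "unlift_var a'" and ?\<beta> = "unlift_var b'"
        obtain i r r' where ab': "a' = X i r" "b' = X i r'" "i < 2 * k" "r div d = r' div d"
          using a' q by (auto simp: U_def)
        \<comment> \<open>Equal block and layer mean that both unlifted variables belong to the same
          block of \<open>f\<close>, in which \<open>f\<close> alternates.\<close>
        obtain q0 where q0: "?\<alpha> \<in> {X q0 j | j. j < d}" "?\<beta> \<in> {X q0 j | j. j < d}" "q0 < 2 * (k * ?t)"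
        proof
          show "?\<alpha> \<in> {X (i * ?t + r div d) j | j. j < d}" "?\<beta> \<in> {X (i * ?t + r div d) j | j. j < d}"
            using d_pos ab' by auto
          show "i * ?t + r div d < 2 * (k * ?t)"
            using unlift_U(1)[OF a'(1)] unfolding ab'(1) unlift_var.simps U'_def by blast
        qed
        have \<alpha>\<beta>: "?\<alpha> \<in> U'" "?\<beta> \<in> U'" "lift_var ?\<alpha> = a'" "lift_var ?\<beta> = b'"
          using unlift_U a' by auto
        have deg: "lift_degree ?\<alpha> = lift_degree ?\<beta>" by (simp add: ab')
        have "Q.eval_hpoly (\<theta> (transpose a b \<circ> \<tau>)) f = Q.eval_hpoly (\<theta> \<tau> \<circ> transpose ?\<alpha> ?\<beta>) f"
        proof (rule Q.eval_hpoly_cong[OF f'])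
          fix x assume x: "x \<in> U' \<union> ZV"
          have "x = ?\<alpha> \<longleftrightarrow> lift_var x = a'" "x = ?\<beta> \<longleftrightarrow> lift_var x = b'"
            using unlift[OF x] \<alpha>\<beta>(3,4) by metis+
          then have lift: "lift_var (transpose ?\<alpha> ?\<beta> x) = transpose a' b' (lift_var x)"
            using \<alpha>\<beta>(3,4) by (simp only: transpose_def split: if_split) metis
          have "lift_degree (transpose ?\<alpha> ?\<beta> x) = lift_degree x"
            using deg by (simp only: transpose_def split: if_split) metis
          with lift show "\<theta> (transpose a b \<circ> \<tau>) x = (\<theta> \<tau> \<circ> transpose ?\<alpha> ?\<beta>) x"
            by (simp only: comp \<theta>_def comp_apply)
        qed
        also have "\<dots> = s (of_int (sign (transpose ?\<alpha> ?\<beta>))) (Q.eval_hpoly (\<theta> \<tau>) f)"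
          by (rule Q.eval_hpoly_alternating[OF f_alt[OF q0(3)] permutes_swap_id[OF q0(1,2)] \<theta>B])
        also have "sign (transpose ?\<alpha> ?\<beta>) = - 1"
          using ne \<alpha>\<beta>(3,4) by (intro sign_transpose) metis
        finally have ev: "Q.eval_hpoly (\<theta> (transpose a b \<circ> \<tau>)) f = - Q.eval_hpoly (\<theta> \<tau>) f"
          by (simp only: of_int_minus of_int_1 Q.scale_minus_left Q.scale_one)
        have "sign (transpose a b \<circ> \<tau>) = sign (transpose a b) * sign \<tau>"
          using finU swap(1,3,4)
          by (intro sign_compose) (auto simp: permutation_permutes intro!: exI[of _ U] permutes_swap_id)
        then have "sign (transpose a b \<circ> \<tau>) = - sign \<tau>" using sign_transpose[OF swap(5)] by simp
        with ev swap(7) show ?case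
          by (simp only: of_int_minus Q.scale_minus_left Q.scale_minus_right minus_minus)
      qed
    qed
    have term_not_H: "Q.eval_hpoly (\<theta> \<sigma>) f = 0" if \<sigma>: "\<sigma> \<in> ?G" "\<sigma> \<notin> ?H" for \<sigma>
    proof -
      have perm: "\<sigma> permutes U" and bl: "\<And>x. block (\<sigma> x) = block x"
        using \<sigma>(1) by (auto simp: block_permutations_def)
      \<comment> \<open>The total of all layers is invariant under a permutation. If no layer
        dropped, none could rise, and all layers would be preserved.\<close>
      have "\<exists>x\<in>U. layer d (\<sigma> x) < layer d x"
      proof (rule ccontr)
        assume "\<not> (\<exists>x\<in>U. layer d (\<sigma> x) < layer d x)"
        then have le: "layer d x \<le> layer d (\<sigma> x)" if "x \<in> U" for x using that by (meson not_le)
        have "(\<Sum>x\<in>U. layer d x) = (\<Sum>x\<in>U. layer d (\<sigma> x))"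
          using sum.permute[OF perm, of "layer d"] by (simp add: comp_def)
        then have "layer d x = layer d (\<sigma> x)" if "x \<in> U" for x
          using sum_mono_inv[of "layer d" U "\<lambda>x. layer d (\<sigma> x)" x] le that finU by blast
        then have "layer d (\<sigma> x) = layer d x" for x
          using perm by (cases "x \<in> U") (auto simp: permutes_def)
        then show False using \<sigma>(2) perm bl by (simp add: block_permutations_def)
      qed
      then obtain x where x: "x \<in> U" "layer d (\<sigma> x) < layer d x" by blast
      obtain i r where xr: "x = X i r" "r < ?t * d" using x(1) by (auto simp: U_def)
      have "\<sigma> x \<in> U" using permutes_in_image[OF perm] x(1) by blast
      then obtain i' r' where r': "\<sigma> x = X i' r'" by (auto simp: U_def)
      let ?q0 = "i * ?t + r div d"
      have lt: "r div d < ?t" using xr(2) by (simp only: less_mult_imp_div_less)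
      then have q0: "?q0 mod ?t = r div d" by (simp del: mult_Suc_right)
      have \<alpha>: "unlift_var x = X ?q0 (r mod d)" by (simp add: xr)
      have "lift_var (X ?q0 (r mod d)) = x" using unlift_U(2)[OF x(1)] by (simp only: \<alpha>)
      then have "\<sigma> (lift_var (X ?q0 (r mod d))) = X i' r'" by (simp only: r')
      from \<theta>_X[of \<sigma> ?q0 "r mod d", OF this] have "\<theta> \<sigma> (unlift_var x) = p (layered (r' + (T - ?q0 mod ?t) * d))"
        by (simp only: \<alpha>)
      moreover have "layered (r' + (T - ?q0 mod ?t) * d) \<in> W T"
      proof (rule layered_in_W)
        have "layer d (\<sigma> x) = r' div d" by (simp only: r' layer.simps)
        moreover have "layer d x = r div d" by (simp only: xr layer.simps)
        \<comment> \<open>The exponent of \<open>v\<close> is just enough to raise the original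
          layer of \<open>x\<close> to \<open>T\<close>, so starting from a lower layer it ends
          inside \<open>W T\<close>, which \<open>p\<close> kills.\<close>
        ultimately have "r' div d + (T - r div d) < T" using x(2) lt by linarith
        then have "(r' + (T - r div d) * d) div d < T" using d_pos by simp
        then show "r' + (T - ?q0 mod ?t) * d < T * d"
          unfolding q0 using d_pos by (simp only: div_less_iff_less_mult)
      qed
      ultimately have "\<theta> \<sigma> (unlift_var x) = 0" by (simp add: p_W_zero)
      then show ?thesis
        using unlift_U(1)[OF x(1)] \<theta>B by (intro Q.eval_hpoly_zero[OF f', of "unlift_var x"]) auto
    qed
    have "p (eval_hpoly \<rho> F) = (\<Sum>\<sigma>\<in>?G. s (of_int (sign \<sigma>)) (p (eval_hpoly (\<rho> \<circ> \<sigma>) (lift_hpoly f))))"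
    proof -
      interpret L: Vector_Spaces.linear pscale scale "eval_hpoly \<rho>" by (rule eval_hpoly_linear)
      show ?thesis
        by (simp add: F_def alternate_def L.sum L.scale eval_hpoly_rename p.sum p.scale)
    qed
    also have "\<dots> = (\<Sum>\<sigma>\<in>?G. s (of_int (sign \<sigma>)) (Q.eval_hpoly (\<theta> \<sigma>) f))"
      by (intro sum.cong refl) (subst eval_lift[OF f'], auto simp: \<rho>A \<theta>_def[abs_def])
    also have "\<dots> = (\<Sum>\<sigma>\<in>?H. s (of_int (sign \<sigma>)) (Q.eval_hpoly (\<theta> \<sigma>) f))"
      using HG finite_block_permutations[OF finU] term_not_H by (intro sum.mono_neutral_right) auto
    also have "\<dots> = (\<Sum>\<sigma>\<in>?H. c)" using term_H by (rule sum.cong[OF refl])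
    also have "\<dots> = s (of_nat (card ?H)) c" by (rule Q.sum_constant_scale)
    finally have "p (eval_hpoly \<rho> F) = s (of_nat (card ?H)) c" .
    moreover have "card ?H \<noteq> 0"
    proof -
      have "id \<in> ?H" by (simp add: block_permutations_def permutes_id)
      then show ?thesis using finite_block_permutations[OF finU] by (metis card_0_eq empty_iff)
    qed
    \<comment> \<open>The positive integer \<open>card ?H\<close> stays nonzero in the field because
      the characteristic is 0.\<close>
    ultimately have "p (eval_hpoly \<rho> F) \<noteq> 0" using c_nz by simp
    then have F_nz: "eval_hpoly \<rho> F \<noteq> 0" by auto
    let ?\<rho>0 = "case_var (\<lambda>i j. as ! j) (\<lambda>j. zs' ! j)"
    have "eval_hpoly ?\<rho>0 F \<noteq> 0"
    proof
      assume zero: "eval_hpoly ?\<rho>0 F = 0"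
      \<comment> \<open>Transfer to the given basis: an alternating polynomial that vanishes on
        \<open>as\<close> vanishes for all values in the blocks, in particular on the layered
        basis.\<close>
      have "eval_hpoly \<rho> F = 0"
      proof (rule alternating_vanishes_if_on_basis[OF _ F basis _ _ F_alt _ zero])
        show "U = {X i j | i j. i < 2 * k \<and> j < length as}" by (simp only: U_def len)
        show "\<rho> x = ?\<rho>0 x" if "x \<in> U \<union> ZV - U" for x
          using that by (auto simp: ZV_def \<rho>_def)
      qed (auto simp: \<rho>A)
      with F_nz show False by simp
    qed
    moreover have "alternating_in hscale UNIV {X i j | j. j < length as} F" if "i < 2 * k" for i
      unfolding F_def len using that by (intro alternating_in_alternate finU) (auto simp: U_def)
    moreover have "multilinear_hpoly UNIV ({X i j | i j. i < 2 * k \<and> j < length as} \<union> {Z j | j. j < length zs'}) F"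
      using F by (simp only: U_def ZV_def len len_zs')
    ultimately show ?thesis using zs(1) zs'_A len_zs' by (intro exI[of _ F] exI[of _ zs']) auto
  qed
  then show ?thesis
    using unital_lift[OF Q_unital] unfolding property_star_def by blast
qed

end

theorem theorem6p3:
  fixes hscale :: "'f::{alg_closed_field, field_char_0} \<Rightarrow> 'h::ring_1 \<Rightarrow> 'h"
    and comult :: "'h \<Rightarrow> ('h \<times> 'h \<Rightarrow>\<^sub>0 'f)"
    and counit :: "'h \<Rightarrow> 'f"
    and antipode :: "'h \<Rightarrow> 'h"
    and Ht :: "'h set"
    and v g1 g2 :: 'h
    and scale :: "'f \<Rightarrow> 'a::ab_group_add \<Rightarrow> 'a"
  assumes hopf: "hopf_algebra hscale comult counit antipode"
    and hopf_sub: "hopf_algebra.hopf_subalgebra hscale comult antipode Ht"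
    and generated: "hopf_algebra.subalgebra hscale hull (Ht \<union> {v}) = UNIV"
    and group_like: "g1 \<in> hopf_algebra.group_likes hscale comult Ht"
      "g2 \<in> hopf_algebra.group_likes hscale comult Ht"
    and skew_primitive: "tensor2_eq hscale (comult v) (pure (g1, v) + pure (v, g2))"
    and automorphism: "\<exists>\<phi>. hopf_algebra.algebra_automorphism_on hscale Ht \<phi> \<and>
      (\<forall>h\<in>Ht. v * h - \<phi> h * v \<in> Ht)"
    and subalgebra_star: "all_simple_have_property_star hscale comult counit antipode Ht
      (pscale :: 'f \<Rightarrow> (nat \<Rightarrow>\<^sub>0 'f) \<Rightarrow> (nat \<Rightarrow>\<^sub>0 'f))"
  shows "all_simple_have_property_star hscale comult counit antipode UNIV scale"
  unfolding all_simple_have_property_star_def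
proof (intro allI impI, elim conjE)
  fix A mul act as
  assume alg: "module_algebra hscale comult counit antipode scale A mul UNIV act"
    and fd: "module_algebra.finite_dimensional scale A"
    and simple: "module_algebra.simple scale A mul UNIV act"
    and basis: "module_algebra.is_basis scale A as"
  obtain \<phi> where \<phi>: "hopf_algebra.algebra_automorphism_on hscale Ht \<phi>"
    "\<And>h. h \<in> Ht \<Longrightarrow> v * h - \<phi> h * v \<in> Ht"
    using automorphism by blast
  interpret skew_primitive_module_algebra hscale comult counit antipode scale A mul act Ht v g1 g2 \<phi>
    by (intro skew_primitive_module_algebra.intro skew_primitive_module_algebra_axioms.intro alg
        hopf_sub generated group_like skew_primitive \<phi>)
  obtain I T where "simple_chain hscale comult counit antipode scale A mul act Ht v g1 g2 \<phi> I T"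
    using simple_chain_exists[OF fd simple] .
  then interpret simple_chain hscale comult counit antipode scale A mul act Ht v g1 g2 \<phi> I T .
  obtain B where B: "finite B" "span B = A" using fd by (auto simp: finite_dimensional_def)
  obtain C where "finite C" "independent C" "span C = I"
    using subspace_bounded_dim[OF B(1) I_simps(1)] I_simps(2) B(2) by metis
  moreover from this obtain cs where "set cs = C" "distinct cs"
    using finite_distinct_list by blast
  ultimately have cs: "distinct cs" "independent (set cs)" "span (set cs) = I" by simp_all
  \<comment> \<open>The quotient is placed in \<open>nat \<Rightarrow>\<^sub>0 'f\<close> because
    the hypothesis on \<open>Ht\<close> speaks of algebras on subspaces of that space.\<close>
  obtain p :: "'a \<Rightarrow> (nat \<Rightarrow>\<^sub>0 'f)" where p: "Vector_Spaces.linear scale pscale p"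
    "\<And>a. a \<in> A \<Longrightarrow> p a = 0 \<longleftrightarrow> a \<in> W T"
    using linear_map_with_kernel[OF B(1) W_simps(1,2) B(2)] by blast
  obtain mul' act' where Q: "module_algebra hscale comult counit antipode pscale (p ` A) mul' Ht act'"
    "\<And>a b. a \<in> A \<Longrightarrow> b \<in> A \<Longrightarrow> mul' (p a) (p b) = p (mul a b)"
    "\<And>h a. h \<in> Ht \<Longrightarrow> a \<in> A \<Longrightarrow> act' h (p a) = p (act h a)"
    using R.quotient_module_algebra[OF W_ideal p] by blast
  interpret simple_chain_quotient hscale comult counit antipode scale A mul act Ht v g1 g2 \<phi> I T
      pscale p mul' act' cs
    by (intro simple_chain_quotient.intro simple_chain_quotient_axioms.intro simple_chain_axioms Q p cs)
  have "Q.property_star top_basis"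
    using subalgebra_star Q(1) quotient_finite_dimensional quotient_simple top_basis
    unfolding all_simple_have_property_star_def by blast
  then show "module_algebra.property_star hscale scale A mul UNIV act as"
    using basis by (rule lift_property_star)
qed

end
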